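(* Let $n>1$, let $O\sqcup C=P\setminus A$ be any partition and let $\mathbf d=(d_1,\dots,d_l)$ with $1\le d_1<\dots<d_l\le n-1$. The $(O,C)$-standard monomials in $S_{\mathbf d}$ are precisely the monomials $$X_{i^1_1,\dots,i^1_{k_1}}\cdots X_{i^m_1,\dots,i^m_{k_m}}\in S_{\mathbf d}$$ with $k_1\ge\dots\ge k_m$ for which the Young tableau $Y$ with $Y_{j,l}=i^j_l$, i.e. with $j$th column $(i^j_1,\dots,i^j_{k_j})$, is $(O,C)$-semistandard. In particular, the set of such monomials projects to a basis in the Plücker algebra $R_{\mathbf d}\simeq S_{\mathbf d}/I_{\mathbf d}$.
   Context: **Poset and permutations.** $P=\{(i,j):1\le i\le j\le n\}$ is ordered by $(i,j)\preceq(i',j')$ iff $i\le i'$ and $j\le j'$. $A=\{(1,1),\dots,(n,n)\}$. $\mathcal J$ is the set of order ideals (lower sets) of $(P,\prec)$, $\mathcal J_k=\{J\in\mathcal J:|J\cap A|=k\}$, $\mathcal J_{\mathbf d}=\mathcal J_{d_1}\cup\dots\cup\mathcal J_{d_l}$. For $J\in\mathcal J$ put $M_{O,C}(J)=(J\cap(O\cup A))\cup\max_\prec(J)$, where $\max_\prec(J)$ is the set of $\prec$-maximal elements of $J$. For $M\subset P$ let $w_M\in\mathcal S_n$ be the product of the transpositions $s_{i,j}=(i\ j)$ over $(i,j)\in M$ (with $s_{i,i}=\mathrm{id}$), ordered by $i$ increasing from left to right and, within a given $i$, by $j$ increasing from left to right; in a product the rightmost factor acts first. Put $w^J=w_{M_{O,C}(J)}$.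 **Plücker algebra.** $S_{\mathbf d}=\mathbb C[X_{i_1,\dots,i_k}]_{k\in\mathbf d,\,1\le i_1<\dots<i_k\le n}$, with the convention $X_{i_1,\dots,i_k}=(-1)^\sigma X_{i_{\sigma(1)},\dots,i_{\sigma(k)}}$ for $\sigma\in\mathcal S_k$. $I_{\mathbf d}$ is the kernel and $R_{\mathbf d}$ the image of the map $S_{\mathbf d}\to\mathbb C[z_{i,j}]_{1\le i\le n-1,1\le j\le n}$ sending $X_{i_1,\dots,i_k}$ to the minor of $(z_{i,j})$ on rows $1,\dots,k$ and columns $i_1,\dots,i_k$. **Standard monomials.** $\mathbb C[\mathcal J_{\mathbf d}]$ is the polynomial ring in variables $X_J$, $J\in\mathcal J_{\mathbf d}$; $\psi:\mathbb C[\mathcal J_{\mathbf d}]\to S_{\mathbf d}$ is the homomorphism with $\psi(X_J)=X_{w^J(1),\dots,w^J(|J\cap A|)}$. The $(O,C)$-standard monomials are the images under $\psi$ of the monomials $X_{J_1}\cdots X_{J_m}$ with $J_1\subset\dots\subset J_m$, $J_i\in\mathcal J_{\mathbf d}$ (equivalently, of the monomials not lying in the ideal generated by all $X_{J_1}X_{J_2}$ with $J_1\not\subset J_2$ and $J_2\not\subset J_1$). **The permutations $\sigma_i$.** For $(i,j)\in P$ let $\langle(i,j)\rangle\in\mathcal J$ be the principal order ideal $\{p\preceq(i,j)\}$. For $1\le i,j\le n$ set $r(i,j)=w^{\langle(i,j)\rangle}(i)$ if $i\le j$ and $r(i,j)=w_O(j)$ if $i>j$. For every $i$ the numbers $r(i,1),\dots,r(i,n)$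 form a permutation of $[1,n]$; $\sigma_i$ denotes the inverse permutation, so $\sigma_i(r(i,j))=j$. **$(O,C)$-tuples and tableaux.** For $1\le k\le n-1$ a tuple $(i_1,\dots,i_k)$ of pairwise distinct integers in $[1,n]$ is an $(O,C)$-tuple if $\sigma_j(i_j)\ge j$ for $1\le j\le k$ and, for any $1\le j<l\le k$, either $\sigma_{j+1}(i_j)=j$ or $\sigma_{j+1}(i_j)>\sigma_l(i_l)$. Let $Y$ be a Young tableau in English notation with $m$ columns, the $i$th column of height $k_i$, and $Y_{i,j}$ the element in the $j$th cell from the top of the $i$th column. $Y$ is $(O,C)$-semistandard if (a) $(Y_{i,1},\dots,Y_{i,k_i})$ is an $(O,C)$-tuple for every $i\in[1,m]$, and (b) for any $i'\le i$ in $[1,m]$ and $j\in[1,k_i]$ there exists $j'\in[j,k_{i'}]$ with $\sigma_{j'}(Y_{i',j'})\ge\sigma_j(Y_{i,j})$. *)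

theory Defs
  imports
    "HOL-Library.Poly_Mapping"
    "HOL-Combinatorics.Permutations"
    "Jordan_Normal_Form.Determinant"
begin

section \<open>The poset and its order ideals\<close>

definition pos :: "nat \<Rightarrow> (nat \<times> nat) set" where
  "pos n = {(i, j). 1 \<le> i \<and> i \<le> j \<and> j \<le> n}"

definition ple :: "nat \<times> nat \<Rightarrow> nat \<times> nat \<Rightarrow> bool"  (infix \<open>\<preceq>\<close> 50) where
  "p \<preceq> q \<longleftrightarrow> fst p \<le> fst q \<and> snd p \<le> snd q"

definition diag :: "nat \<Rightarrow> (nat \<times> nat) set" where
  "diag n = {(i, i) | i. 1 \<le> i \<and> i \<le> n}"

definition order_ideals :: "nat \<Rightarrow> (nat \<times> nat) set set" where
  "order_ideals n = {J. J \<subseteq> pos n \<and> (\<forall>q\<in>J. \<forall>p\<in>pos n. p \<preceq> q \<longrightarrow> p \<in> J)}"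

definition order_ideals_in :: "nat \<Rightarrow> nat set \<Rightarrow> (nat \<times> nat) set set" where
  "order_ideals_in n D = {J \<in> order_ideals n. card (J \<inter> diag n) \<in> D}"

definition principal_ideal :: "nat \<Rightarrow> nat \<times> nat \<Rightarrow> (nat \<times> nat) set" where
  "principal_ideal n q = {p \<in> pos n. p \<preceq> q}"

definition maximal_elems :: "(nat \<times> nat) set \<Rightarrow> (nat \<times> nat) set" where
  "maximal_elems J = {p \<in> J. \<forall>q\<in>J. p \<preceq> q \<longrightarrow> q = p}"

text \<open>In a partition of the complement of the diagonal into two parts, the second part is
  determined by the first one. The constructions below only involve the first part, called
  \<open>Os\<close>; the second part is called \<open>Cs\<close> (a single capital O is reserved syntax).\<close>

definition M_OC :: "nat \<Rightarrow> (nat \<times> nat) set \<Rightarrow> (nat \<times> nat) set \<Rightarrow> (nat \<times> nat) set" where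
  "M_OC n Os J = (J \<inter> (Os \<union> diag n)) \<union> maximal_elems J"


section \<open>Permutations\<close>

text \<open>Permutations of \<open>{1..n}\<close> are functions on \<open>nat\<close> fixing everything else. Factors are listed
  from left to right in lexicographic order of \<open>(i, j)\<close>; under composition the rightmost factor
  acts first.\<close>

definition w_perm :: "nat \<Rightarrow> (nat \<times> nat) set \<Rightarrow> nat \<Rightarrow> nat" where
  "w_perm n M = foldr (\<circ>)
     [Transposition.transpose i j. i \<leftarrow> [1..<Suc n], j \<leftarrow> [i..<Suc n], (i, j) \<in> M] id"

definition w_ideal :: "nat \<Rightarrow> (nat \<times> nat) set \<Rightarrow> (nat \<times> nat) set \<Rightarrow> nat \<Rightarrow> nat" where
  "w_ideal n Os J = w_perm n (M_OC n Os J)"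

definition r_num :: "nat \<Rightarrow> (nat \<times> nat) set \<Rightarrow> nat \<Rightarrow> nat \<Rightarrow> nat" where
  "r_num n Os i j =
     (if i \<le> j then w_ideal n Os (principal_ideal n (i, j)) i else w_perm n Os j)"

definition sigma :: "nat \<Rightarrow> (nat \<times> nat) set \<Rightarrow> nat \<Rightarrow> nat \<Rightarrow> nat" where
  "sigma n Os i = inv_into {1..n} (r_num n Os i)"


section \<open>Polynomial rings\<close>

text \<open>Complex polynomials in commuting variables indexed by a type: a monomial is a finitely
  supported exponent function, a polynomial a finitely supported coefficient function. The ring
  structure is the one of \<^theory>\<open>HOL-Library.Poly_Mapping\<close>.\<close>

type_synonym 'v cpoly = "('v \<Rightarrow>\<^sub>0 nat) \<Rightarrow>\<^sub>0 complex"

definition Var :: "'v \<Rightarrow> 'v cpoly" where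
  "Var v = Poly_Mapping.single (Poly_Mapping.single v 1) 1"

definition Const :: "complex \<Rightarrow> 'v cpoly" where
  "Const c = Poly_Mapping.single 0 c"

definition scale_cpoly :: "complex \<Rightarrow> 'v cpoly \<Rightarrow> 'v cpoly" where
  "scale_cpoly c p = Const c * p"

interpretation cpoly: vector_space scale_cpoly
  by unfold_locales
    (auto simp: scale_cpoly_def Const_def algebra_simps single_add mult_single
      simp flip: mult.assoc)

definition polys_over :: "'v set \<Rightarrow> 'v cpoly set" where
  "polys_over V = {p. \<forall>m\<in>Poly_Mapping.keys p. Poly_Mapping.keys m \<subseteq> V}"

text \<open>The homomorphism of \<open>\<complex>\<close>-algebras sending each variable \<open>v\<close> to \<open>f v\<close>.\<close>

definition poly_hom :: "('v \<Rightarrow> 'w cpoly) \<Rightarrow> 'v cpoly \<Rightarrow> 'w cpoly" where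
  "poly_hom f p = (\<Sum>m\<in>Poly_Mapping.keys p.
     Const (Poly_Mapping.lookup p m) *
     (\<Prod>v\<in>Poly_Mapping.keys m. f v ^ Poly_Mapping.lookup m v))"


section \<open>The Pluecker algebra\<close>

definition pluecker_indices :: "nat \<Rightarrow> nat set \<Rightarrow> nat list set" where
  "pluecker_indices n D = {is. sorted_wrt (<) is \<and> set is \<subseteq> {1..n} \<and> length is \<in> D}"

definition pluecker_poly_ring :: "nat \<Rightarrow> nat set \<Rightarrow> nat list cpoly set" where
  "pluecker_poly_ring n D = polys_over (pluecker_indices n D)"

text \<open>The element \<open>X\<^bsub>i1,...,ik\<^esub>\<close> for an arbitrary tuple; the actual variables are those of the
  strictly increasing tuples. For repeated entries the sign convention forces the value 0.\<close>

definition X_pl :: "nat list \<Rightarrow> nat list cpoly" where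
  "X_pl is =
     (if distinct is
      then of_int (sign (THE s. s permutes {..<length is} \<and> permute_list s is = sort is))
           * Var (sort is)
      else 0)"

definition minor :: "nat list \<Rightarrow> (nat \<times> nat) cpoly" where
  "minor is = det (mat (length is) (length is) (\<lambda>(a, b). Var (a + 1, is ! b)))"

definition pluecker_map :: "nat list cpoly \<Rightarrow> (nat \<times> nat) cpoly" where
  "pluecker_map = poly_hom minor"

definition pluecker_algebra :: "nat \<Rightarrow> nat set \<Rightarrow> (nat \<times> nat) cpoly set" where
  "pluecker_algebra n D = pluecker_map ` pluecker_poly_ring n D"


section \<open>Standard monomials\<close>

definition psi :: "nat \<Rightarrow> (nat \<times> nat) set \<Rightarrow> (nat \<times> nat) set cpoly \<Rightarrow> nat list cpoly" where
  "psi n Os = poly_hom (\<lambda>J. X_pl (map (w_ideal n Os J) [1..<Suc (card (J \<inter> diag n))]))"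

definition standard_monomials ::
    "nat \<Rightarrow> (nat \<times> nat) set \<Rightarrow> nat set \<Rightarrow> nat list cpoly set" where
  "standard_monomials n Os D =
     {psi n Os (\<Prod>J\<leftarrow>Js. Var J) | Js. set Js \<subseteq> order_ideals_in n D \<and> sorted_wrt (\<subseteq>) Js}"


section \<open>Tuples and tableaux\<close>

text \<open>The \<open>j\<close>-th entry of the tuple \<open>is\<close>, counted from 1, is \<open>is ! (j - 1)\<close>.\<close>

definition OC_tuple :: "nat \<Rightarrow> (nat \<times> nat) set \<Rightarrow> nat list \<Rightarrow> bool" where
  "OC_tuple n Os is \<longleftrightarrow>
     (let k = length is; e = (\<lambda>j. is ! (j - 1)) in
       1 \<le> k \<and> k \<le> n - 1 \<and> distinct is \<and> set is \<subseteq> {1..n} \<and>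
       (\<forall>j. 1 \<le> j \<and> j \<le> k \<longrightarrow> sigma n Os j (e j) \<ge> j) \<and>
       (\<forall>j l. 1 \<le> j \<and> j < l \<and> l \<le> k \<longrightarrow>
          sigma n Os (j + 1) (e j) = j \<or> sigma n Os (j + 1) (e j) > sigma n Os l (e l)))"

text \<open>A tableau is the list of its columns, each column being listed from top to bottom.\<close>

definition young_tableau :: "nat list list \<Rightarrow> bool" where
  "young_tableau Y \<longleftrightarrow> sorted_wrt (\<ge>) (map length Y)"

definition OC_semistandard :: "nat \<Rightarrow> (nat \<times> nat) set \<Rightarrow> nat list list \<Rightarrow> bool" where
  "OC_semistandard n Os Y \<longleftrightarrow>
     (let m = length Y; ht = (\<lambda>i. length (Y ! (i - 1))); e = (\<lambda>i j. Y ! (i - 1) ! (j - 1)) in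
       (\<forall>i\<in>{1..m}. OC_tuple n Os (Y ! (i - 1))) \<and>
       (\<forall>i\<in>{1..m}. \<forall>i'\<in>{1..i}. \<forall>j\<in>{1..ht i}. \<exists>j'\<in>{j..ht i'}.
          sigma n Os j' (e i' j') \<ge> sigma n Os j (e i j)))"

definition tableau_monomials ::
    "nat \<Rightarrow> (nat \<times> nat) set \<Rightarrow> nat set \<Rightarrow> nat list cpoly set" where
  "tableau_monomials n Os D =
     {(\<Prod>col\<leftarrow>Y. X_pl col) | Y.
        young_tableau Y \<and> (\<forall>col\<in>set Y. length col \<in> D) \<and> OC_semistandard n Os Y}"

end

theory Submission
  imports Defs
begin

text \<open>
  In \<open>w\<^sub>M\<close> every element \<open>(i, j)\<close> of \<open>M\<close> acts as a transposition, and \<open>w\<^sub>M(x)\<close> is read off by starting in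
  row \<open>x\<close> at its last element and walking up, shifting to the previous element of a row whenever an element
  is hit. Hence \<open>r(j, \<cdot>)\<close> is the product \<open>U\<^sub>j\<close> of the row permutations of \<open>O\<close> above row \<open>j\<close>
  (\<open>r_num_upper_rows\<close>), \<open>\<sigma>\<^sub>j\<close> is its inverse, and \<open>\<sigma>\<^sub>j\<close>, \<open>\<sigma>\<^bsub>j+1\<^esub>\<close> differ by one row permutation
  (\<open>\<sigma>_step\<close>). An order ideal \<open>J\<close> with \<open>k\<close> diagonal elements is given by the ends
  \<open>m\<^sub>1 \<ge> \<dots> \<ge> m\<^sub>k \<ge> k\<close> of its rows, and \<open>\<sigma>\<^sub>j(w\<^sup>J(j))\<close> is the last entry of \<open>M(J)\<close> in row \<open>j\<close>. From the
  tuple one gets \<open>J\<close> back by \<open>m\<^sub>j = max \<sigma>\<^sub>l(w\<^sup>J(l))\<close> over \<open>l \<ge> j\<close>. This makes the tuples of order ideals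
  exactly the \<open>(O,C)\<close>-tuples (\<open>OC_tuple_tuple\<close>, \<open>OC_tuple_is_tuple\<close>), and turns the condition on two
  columns of a semistandard tableau into inclusion of ideals (\<open>ideal_subset_iff\<close>). So standard
  monomials and tableau monomials agree.

  Linear independence: there is a weight on the variables \<open>z\<^bsub>i,j\<^esub>\<close> for which the diagonal term
  \<open>z\<^bsub>1,i(1)\<^esub> \<cdots> z\<^bsub>k,i(k)\<^esub>\<close> of the minor of any \<open>(O,C)\<close>-tuple \<open>(i(1), \<dots>, i(k))\<close> is the unique one of maximal weight (\<open>minor_leads\<close>). The leading
  exponent of a product over a chain of ideals determines, position by position, how many ideals of
  the chain contain that position, and these numbers determine the chain
  (\<open>chain_determined_by_lead_exponent\<close>). Distinct chains therefore have distinct leading terms.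

  Spanning: the Garnir relations express every product of minors through products over chains of
  columns, where columns are compared as in classical semistandard tableaux (\<open>column_straightening\<close>). Such
  chains of columns inject into chains of order ideals of the same length, so in each degree
  there are at least as many independent products over chains of ideals as there are elements in a
  spanning set of the same space (\<open>column_chains_span\<close>). Hence the independent family also spans, for
  every choice of \<open>O\<close>, although straightening is carried out for the classical columns only.
\<close>

section \<open>Evaluation of polynomials\<close>

lemma Const_simps:
  "Const 0 = 0" "Const 1 = 1" "Const (a + b) = Const a + Const b" "Const (a * b) = Const a * Const b"
  by (simp_all add: Const_def single_add mult_single)

lemma lookup_Const_mult: "Poly_Mapping.lookup (Const c * p) m = c * Poly_Mapping.lookup p m"
  unfolding Const_def mult_map_scale_conv_mult [symmetric] by (simp add: map.rep_eq when_def)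

definition monom_eval :: "('v \<Rightarrow> 'w cpoly) \<Rightarrow> ('v \<Rightarrow>\<^sub>0 nat) \<Rightarrow> 'w cpoly" where
  "monom_eval f m = (\<Prod>v\<in>Poly_Mapping.keys m. f v ^ Poly_Mapping.lookup m v)"

text \<open>The keys of a sum depend on cancellation. Extending products and sums to any finite superset of the
  keys makes them additive; the same device serves for \<open>poly_hom\<close> and for weights.\<close>

lemma monom_eval_superset:
  assumes "finite A" "Poly_Mapping.keys m \<subseteq> A"
  shows "monom_eval f m = (\<Prod>v\<in>A. f v ^ Poly_Mapping.lookup m v)"
  unfolding monom_eval_def using assms
  by (intro prod.mono_neutral_left) (auto simp: in_keys_iff)

lemma monom_eval_add: "monom_eval f (m + m') = monom_eval f m * monom_eval f m'"
proof -
  let ?A = "Poly_Mapping.keys m \<union> Poly_Mapping.keys m'"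
  have "monom_eval f (m + m') = (\<Prod>v\<in>?A. f v ^ Poly_Mapping.lookup (m + m') v)"
    using keys_add[of m m'] by (intro monom_eval_superset) auto
  also have "\<dots> = monom_eval f m * monom_eval f m'"
    by (simp add: lookup_add power_add prod.distrib monom_eval_superset[of ?A])
  finally show ?thesis .
qed

lemma poly_hom_superset:
  assumes "finite A" "Poly_Mapping.keys p \<subseteq> A"
  shows "poly_hom f p = (\<Sum>m\<in>A. Const (Poly_Mapping.lookup p m) * monom_eval f m)"
  unfolding poly_hom_def monom_eval_def using assms
  by (intro sum.mono_neutral_left) (auto simp: in_keys_iff Const_simps)

lemma poly_hom_add: "poly_hom f (p + q) = poly_hom f p + poly_hom f q"
proof -
  let ?A = "Poly_Mapping.keys p \<union> Poly_Mapping.keys q"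
  have "poly_hom f (p + q) = (\<Sum>m\<in>?A. Const (Poly_Mapping.lookup (p + q) m) * monom_eval f m)"
    using keys_add[of p q] by (intro poly_hom_superset) auto
  also have "\<dots> = poly_hom f p + poly_hom f q"
    by (simp add: lookup_add Const_simps distrib_right sum.distrib poly_hom_superset[of ?A])
  finally show ?thesis .
qed

lemma poly_hom_0: "poly_hom f 0 = 0"
  by (simp add: poly_hom_def)

lemma poly_hom_sum: "poly_hom f (\<Sum>i\<in>I. p i) = (\<Sum>i\<in>I. poly_hom f (p i))"
  by (induction I rule: infinite_finite_induct) (auto simp: poly_hom_add poly_hom_0)

lemma poly_hom_single: "poly_hom f (Poly_Mapping.single m c) = Const c * monom_eval f m"
  by (subst poly_hom_superset[of "{m}"]) auto

lemma cpoly_expand: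
  "p = (\<Sum>m\<in>Poly_Mapping.keys p. Poly_Mapping.single m (Poly_Mapping.lookup p m))"
  by (rule poly_mapping_eqI)
    (auto simp: lookup_sum lookup_single when_def sum.delta' in_keys_iff cong: if_cong)

lemma poly_hom_mult: "poly_hom f (p * q) = poly_hom f p * poly_hom f q"
proof -
  have s: "poly_hom f (Poly_Mapping.single m c * Poly_Mapping.single m' c')
      = poly_hom f (Poly_Mapping.single m c) * poly_hom f (Poly_Mapping.single m' c')" for m c m' c'
    by (simp add: mult_single poly_hom_single monom_eval_add Const_simps)
  have "poly_hom f ((\<Sum>m\<in>A. Poly_Mapping.single m (c m)) * (\<Sum>m\<in>B. Poly_Mapping.single m (d m)))
      = poly_hom f (\<Sum>m\<in>A. Poly_Mapping.single m (c m))
        * poly_hom f (\<Sum>m\<in>B. Poly_Mapping.single m (d m))" for A B c d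
    by (simp add: sum_distrib_left sum_distrib_right poly_hom_sum s)
  from this[of "Poly_Mapping.lookup p" "Poly_Mapping.keys p" "Poly_Mapping.lookup q" "Poly_Mapping.keys q"]
  show ?thesis by (simp flip: cpoly_expand)
qed

lemma poly_hom_Const: "poly_hom f (Const c) = Const c"
  by (simp add: Const_def poly_hom_single monom_eval_def)

lemma poly_hom_Var: "poly_hom f (Var v) = f v"
  by (simp add: Var_def poly_hom_single monom_eval_def Const_simps)

lemma poly_hom_1: "poly_hom f 1 = 1"
  using poly_hom_Const[of f 1] by (simp add: Const_simps)

lemma of_int_eq_Const: "of_int k = Const (of_int k)"
  by (simp add: Const_def)

lemma poly_hom_of_int: "poly_hom f (of_int k) = of_int k"
  by (simp add: of_int_eq_Const poly_hom_Const)

lemma poly_hom_prod_list: "poly_hom f (\<Prod>x\<leftarrow>xs. g x) = (\<Prod>x\<leftarrow>xs. poly_hom f (g x))"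
  by (induction xs) (auto simp: poly_hom_1 poly_hom_mult)

lemma scale_cpoly_mult: "scale_cpoly c (p * q) = scale_cpoly c p * q" "scale_cpoly c (p * q) = p * scale_cpoly c q"
  by (simp_all add: scale_cpoly_def mult_ac)

lemma poly_hom_scale: "poly_hom f (scale_cpoly c p) = scale_cpoly c (poly_hom f p)"
  by (simp add: scale_cpoly_def poly_hom_mult poly_hom_Const)

section \<open>Terms of maximal weight\<close>

definition wt :: "('v \<Rightarrow> nat) \<Rightarrow> ('v \<Rightarrow>\<^sub>0 nat) \<Rightarrow> nat" where
  "wt \<omega> m = (\<Sum>v\<in>Poly_Mapping.keys m. \<omega> v * Poly_Mapping.lookup m v)"

lemma wt_superset:
  assumes "finite A" "Poly_Mapping.keys m \<subseteq> A"
  shows "wt \<omega> m = (\<Sum>v\<in>A. \<omega> v * Poly_Mapping.lookup m v)"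
  unfolding wt_def using assms
  by (intro sum.mono_neutral_left) (auto simp: in_keys_iff)

lemma wt_add: "wt \<omega> (m + m') = wt \<omega> m + wt \<omega> m'"
proof -
  let ?A = "Poly_Mapping.keys m \<union> Poly_Mapping.keys m'"
  have "wt \<omega> (m + m') = (\<Sum>v\<in>?A. \<omega> v * Poly_Mapping.lookup (m + m') v)"
    using keys_add[of m m'] by (intro wt_superset) auto
  also have "\<dots> = wt \<omega> m + wt \<omega> m'"
    by (simp add: lookup_add distrib_left sum.distrib wt_superset[of ?A])
  finally show ?thesis .
qed

lemma wt_0: "wt \<omega> 0 = 0" by (simp add: wt_def)

lemma wt_single: "wt \<omega> (Poly_Mapping.single v k) = \<omega> v * k"
  by (cases "k = 0") (auto simp: wt_def)

lemma wt_sum: "wt \<omega> (\<Sum>i\<in>I. m i) = (\<Sum>i\<in>I. wt \<omega> (m i))"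
  by (induction I rule: infinite_finite_induct) (auto simp: wt_add wt_0)

text \<open>A weight on the variables takes the place of a monomial order. It need not separate monomials, as long
  as the polynomials considered have only one term of maximal weight. The coefficient \<open>1\<close> of this
  term makes the notion stable under products.\<close>

definition leads :: "('v \<Rightarrow> nat) \<Rightarrow> 'v cpoly \<Rightarrow> ('v \<Rightarrow>\<^sub>0 nat) \<Rightarrow> bool" where
  "leads \<omega> p m \<longleftrightarrow> Poly_Mapping.lookup p m = 1 \<and> (\<forall>k\<in>Poly_Mapping.keys p. k \<noteq> m \<longrightarrow> wt \<omega> k < wt \<omega> m)"

lemma leadsI:
  assumes "p = Poly_Mapping.single m 1 + q" "\<And>k. k \<in> Poly_Mapping.keys q \<Longrightarrow> wt \<omega> k < wt \<omega> m"
  shows "leads \<omega> p m"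
proof -
  have "m \<notin> Poly_Mapping.keys q" using assms(2) by blast
  then show ?thesis unfolding leads_def assms(1)
    using keys_add[of "Poly_Mapping.single m 1" q] assms(2)
    by (auto simp: lookup_add in_keys_iff split: if_splits)
qed

lemma leadsE:
  assumes "leads \<omega> p m"
  obtains q where "p = Poly_Mapping.single m 1 + q"
    "\<And>k. k \<in> Poly_Mapping.keys q \<Longrightarrow> wt \<omega> k < wt \<omega> m"
proof
  show "p = Poly_Mapping.single m 1 + (p - Poly_Mapping.single m 1)" by simp
  fix k assume "k \<in> Poly_Mapping.keys (p - Poly_Mapping.single m 1)"
  then show "wt \<omega> k < wt \<omega> m" using assms
    by (cases "k = m") (auto simp: leads_def in_keys_iff lookup_minus lookup_single when_def)
qed

lemma leads_mult:
  assumes "leads \<omega> p m" "leads \<omega> p' m'"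
  shows "leads \<omega> (p * p') (m + m')"
proof -
  from assms(1) obtain q where q: "p = Poly_Mapping.single m 1 + q"
    "\<And>k. k \<in> Poly_Mapping.keys q \<Longrightarrow> wt \<omega> k < wt \<omega> m" by (metis leadsE)
  from assms(2) obtain q' where q': "p' = Poly_Mapping.single m' 1 + q'"
    "\<And>k. k \<in> Poly_Mapping.keys q' \<Longrightarrow> wt \<omega> k < wt \<omega> m'" by (metis leadsE)
  show ?thesis
  proof (rule leadsI)
    show "p * p' = Poly_Mapping.single (m + m') 1
       + (Poly_Mapping.single m 1 * q' + q * Poly_Mapping.single m' 1 + q * q')"
      by (simp add: q q' algebra_simps mult_single)
    fix k
    let ?A = "Poly_Mapping.single m 1 * q'" and ?B = "q * Poly_Mapping.single m' 1" and ?C = "q * q'"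
    assume "k \<in> Poly_Mapping.keys (?A + ?B + ?C)"
    then have "k \<in> Poly_Mapping.keys ?A \<union> Poly_Mapping.keys ?B \<union> Poly_Mapping.keys ?C"
      using keys_add[of "?A + ?B" ?C] keys_add[of ?A ?B] by auto
    moreover have "Poly_Mapping.keys ?A \<subseteq> {m + b | b. b \<in> Poly_Mapping.keys q'}"
      using keys_mult[of "Poly_Mapping.single m 1" q'] by auto
    moreover have "Poly_Mapping.keys ?B \<subseteq> {a + m' | a. a \<in> Poly_Mapping.keys q}"
      using keys_mult[of q "Poly_Mapping.single m' 1"] by auto
    moreover note keys_mult[of q q']
    ultimately consider (a) b where "b \<in> Poly_Mapping.keys q'" "k = m + b"
      | (b) a where "a \<in> Poly_Mapping.keys q" "k = a + m'"
      | (c) a b where "a \<in> Poly_Mapping.keys q" "b \<in> Poly_Mapping.keys q'" "k = a + b"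
      by blast
    then show "wt \<omega> k < wt \<omega> (m + m')"
      by cases (use q(2) q'(2) in \<open>auto simp: wt_add intro: add_strict_mono\<close>)
  qed
qed

lemma leads_1: "leads \<omega> 1 0"
  by (rule leadsI[of _ _ 0]) auto

lemma leads_prod_list:
  assumes "\<And>x. x \<in> set xs \<Longrightarrow> leads \<omega> (g x) (\<mu> x)"
  shows "leads \<omega> (\<Prod>x\<leftarrow>xs. g x) (\<Sum>x\<leftarrow>xs. \<mu> x)"
  using assms by (induction xs) (auto intro!: leads_1 leads_mult)

lemma leads_unique:
  assumes "leads \<omega> p m" "leads \<omega> p m'"
  shows "m = m'"
proof (rule ccontr)
  assume "m \<noteq> m'"
  moreover have "m \<in> Poly_Mapping.keys p" "m' \<in> Poly_Mapping.keys p"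
    using assms by (auto simp: leads_def in_keys_iff)
  ultimately show False using assms unfolding leads_def by (metis less_asym)
qed

text \<open>In a vanishing linear combination look at an element \<open>p\<close> of maximal leading weight among those
  with nonzero coefficient: no other element contributes to the coefficient of \<open>\<nu> p\<close>.\<close>

lemma leads_independent:
  assumes "\<And>p. p \<in> S \<Longrightarrow> leads \<omega> p (\<nu> p)" and inj: "inj_on \<nu> S"
  shows "cpoly.independent S"
  unfolding cpoly.independent_explicit_finite_subsets
proof (intro allI impI ballI)
  fix T u v assume T: "T \<subseteq> S" "finite T" and 0: "(\<Sum>v\<in>T. scale_cpoly (u v) v) = 0" and "v \<in> T"
  show "u v = 0"
  proof (rule ccontr)
    assume "u v \<noteq> 0"
    let ?T = "{v \<in> T. u v \<noteq> 0}"
    have "finite ?T" "?T \<noteq> {}" using T \<open>v \<in> T\<close> \<open>u v \<noteq> 0\<close> by auto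
    then obtain p where p: "p \<in> ?T" "\<And>q. q \<in> ?T \<Longrightarrow> wt \<omega> (\<nu> q) \<le> wt \<omega> (\<nu> p)"
      using Max_in[of "(\<lambda>q. wt \<omega> (\<nu> q)) ` ?T"] Max_ge[of "(\<lambda>q. wt \<omega> (\<nu> q)) ` ?T"]
      by (smt (verit, del_insts) finite_imageI image_iff image_is_empty)
    have z: "u q * Poly_Mapping.lookup q (\<nu> p) = (if q = p then u p else 0)" if "q \<in> T" for q
    proof (cases "q = p \<or> u q = 0")
      case True
      then show ?thesis using p(1) T assms(1)[of p] by (auto simp: leads_def)
    next
      case False
      then have "\<nu> q \<noteq> \<nu> p" using inj_onD[OF inj, of q p] that p(1) T by blast
      moreover have "wt \<omega> (\<nu> q) \<le> wt \<omega> (\<nu> p)" using p(2)[of q] that False by simp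
      moreover have "leads \<omega> q (\<nu> q)" using assms(1) that T by blast
      ultimately have "\<nu> p \<notin> Poly_Mapping.keys q" unfolding leads_def by force
      then show ?thesis using False by (simp add: in_keys_iff)
    qed
    have "0 = Poly_Mapping.lookup (\<Sum>v\<in>T. scale_cpoly (u v) v) (\<nu> p)" using 0 by simp
    also have "\<dots> = (\<Sum>q\<in>T. if q = p then u p else 0)"
      by (simp add: lookup_sum scale_cpoly_def lookup_Const_mult z)
    also have "\<dots> = u p" using T p(1) by simp
    finally show False using p(1) by simp
  qed
qed

section \<open>Minors under permutation of columns\<close>

lemma minor_permute_list:
  assumes s: "s permutes {..<length is}"
  shows "minor (permute_list s is) = of_int (sign s) * minor is"
proof -
  let ?n = "length is"
  let ?A = "mat ?n ?n (\<lambda>(a, b). Var (b + 1, is ! a)) :: (nat \<times> nat) cpoly mat"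
  have s': "s permutes {0..<?n}" using s by (simp add: atLeast0LessThan)
  have lt: "s i < ?n" if "i < ?n" for i using permutes_in_image[OF s, of i] that by auto
  have T: "minor xs = det (mat (length xs) (length xs) (\<lambda>(a, b). Var (b + 1, xs ! a)))" for xs
  proof -
    have "transpose_mat (mat (length xs) (length xs) (\<lambda>(a, b). Var (a + 1, xs ! b)) :: (nat \<times> nat) cpoly mat)
       = mat (length xs) (length xs) (\<lambda>(a, b). Var (b + 1, xs ! a))" by (rule eq_matI) auto
    then show ?thesis unfolding minor_def by (metis det_transpose mat_carrier)
  qed
  have "minor (permute_list s is) = det (mat ?n ?n (\<lambda>(i, j). ?A $$ (s i, j)))"
    unfolding T by (rule arg_cong[of _ _ det], rule eq_matI)
      (auto simp: permute_list_nth[OF s] lt)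
  also have "\<dots> = signof s * det ?A" by (rule det_permute_rows[OF _ s']) simp
  finally show ?thesis unfolding T by simp
qed

lemma minor_not_distinct:
  assumes "\<not> distinct is"
  shows "minor is = 0"
proof -
  from assms obtain i j where ij: "i < length is" "j < length is" "i \<noteq> j" "is ! i = is ! j"
    by (auto simp: distinct_conv_nth)
  show ?thesis unfolding minor_def
    by (rule det_identical_columns[OF _ ij(3,1,2)]) (use ij in \<open>auto intro!: eq_vecI\<close>)
qed

lemma permutes_nat_less: "(p :: nat \<Rightarrow> nat) permutes {0..<n} \<Longrightarrow> i < n \<Longrightarrow> p i < n"
  using permutes_in_image[of p "{0..<n}" i] by auto

lemma minor_expand:
  "minor is = (\<Sum>\<tau> | \<tau> permutes {0..<length is}. of_int (sign \<tau>) * (\<Prod>c = 0..<length is. Var (\<tau> c + 1, is ! c)))"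
  unfolding minor_def
  by (subst det_col[of _ "length is"])
    (auto intro!: sum.cong prod.cong simp: permutes_nat_less atLeast0LessThan)

text \<open>This makes the definite description in the definition of \<open>X_pl\<close> meaningful.\<close>

lemma sorting_permutation:
  assumes "distinct is"
  shows "\<exists>!s. s permutes {..<length is} \<and> permute_list s is = sort is"
proof -
  obtain s where "s permutes {..<length is}" "permute_list s is = sort is"
    using mset_eq_permutation[of "sort is" "is"] by auto
  moreover have "s = t" if s: "s permutes {..<length is}" "permute_list s is = sort is"
    and t: "t permutes {..<length is}" "permute_list t is = sort is" for s t
  proof
    fix x show "s x = t x"
    proof (cases "x < length is")
      case True
      then have "is ! s x = is ! t x"
        using permute_list_nth[OF s(1)] permute_list_nth[OF t(1)] s(2) t(2) by metis
      moreover have "s x < length is" "t x < length is"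
        using True permutes_in_image[OF s(1)] permutes_in_image[OF t(1)] by auto
      ultimately show ?thesis using assms by (simp add: nth_eq_iff_index_eq)
    qed (use permutes_not_in[OF s(1)] permutes_not_in[OF t(1)] in auto)
  qed
  ultimately show ?thesis by blast
qed

lemma pluecker_map_X_pl:
  assumes "distinct is"
  shows "pluecker_map (X_pl is) = minor is"
proof -
  define s where "s = (THE s. s permutes {..<length is} \<and> permute_list s is = sort is)"
  have s: "s permutes {..<length is}" "permute_list s is = sort is"
    using theI'[OF sorting_permutation[OF assms]] unfolding s_def by auto
  have "pluecker_map (X_pl is) = of_int (sign s) * (of_int (sign s) * minor is)"
    using assms s minor_permute_list[OF s(1)]
    by (simp add: X_pl_def pluecker_map_def poly_hom_mult poly_hom_of_int poly_hom_Var flip: s_def)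
  also have "\<dots> = minor is" by (simp flip: mult.assoc of_int_mult)
  finally show ?thesis .
qed

section \<open>Straightening of products of minors\<close>

text \<open>Columns are listed decreasingly, since decreasing columns correspond monotonically to order ideals.\<close>

definition is_col :: "nat \<Rightarrow> nat list \<Rightarrow> bool" where
  "is_col n c \<longleftrightarrow> sorted_wrt (>) c \<and> set c \<subseteq> {1..n}"

lemma is_colI:
  assumes "distinct xs" "set xs \<subseteq> {1..n}"
  shows "is_col n (rev (sort xs))"
  using assms by (simp add: is_col_def sorted_wrt_rev strict_sorted_iff)

lemma minor_sorted_column:
  "\<exists>e :: int. minor xs = of_int e * minor (rev (sort xs))"
proof -
  obtain s where s: "s permutes {..<length xs}" "permute_list s xs = rev (sort xs)"
    using mset_eq_permutation[of "rev (sort xs)" xs] by (metis mset_rev mset_sort)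
  have "of_int (sign s) * minor (rev (sort xs)) = minor xs"
    using minor_permute_list[OF s(1)] unfolding s(2) by (simp flip: mult.assoc of_int_mult)
  then show ?thesis by metis
qed

text \<open>If two of the positions carry the same row of \<open>z\<close>, then exchanging them is a sign-reversing
  involution on the summands.\<close>

lemma alternating_sum_eq_0:
  fixes z :: "nat \<Rightarrow> nat \<Rightarrow> 'v cpoly"
  assumes T: "finite T" "T \<subseteq> U" and xy: "x \<in> T" "y \<in> T" "x \<noteq> y" "z x = z y"
  shows "(\<Sum>\<sigma> | \<sigma> permutes T. of_int (sign \<sigma>) * (\<Prod>t\<in>U. z t (\<sigma> t))) = 0" (is "?S = 0")
proof -
  let ?t = "Transposition.transpose x y"
  have tp: "?t permutes T" using xy by (simp add: permutes_swap_id)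
  have "?S = (\<Sum>\<sigma> | \<sigma> permutes T. of_int (sign (\<sigma> \<circ> ?t)) * (\<Prod>t\<in>U. z t ((\<sigma> \<circ> ?t) t)))"
    by (rule sum.reindex_bij_witness[of _ "\<lambda>\<sigma>. \<sigma> \<circ> ?t" "\<lambda>\<sigma>. \<sigma> \<circ> ?t"])
      (auto simp: comp_assoc intro: permutes_compose[OF tp])
  also have "\<dots> = (\<Sum>\<sigma> | \<sigma> permutes T. - (of_int (sign \<sigma>) * (\<Prod>t\<in>U. z t (\<sigma> t))))"
  proof (intro sum.cong refl, clarify)
    fix \<sigma> assume \<sigma>: "\<sigma> permutes T"
    have "permutation \<sigma>" "permutation ?t"
      using \<sigma> tp T(1) permutation_permutes by blast+
    then have "sign (\<sigma> \<circ> ?t) = - sign \<sigma>" using xy by (simp add: sign_compose sign_swap_id)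
    moreover have "(\<Prod>t\<in>U. z t ((\<sigma> \<circ> ?t) t)) = (\<Prod>t\<in>U. z t (\<sigma> t))"
    proof (rule prod.reindex_bij_witness[of _ ?t ?t])
      fix a assume "a \<in> U"
      show "?t a \<in> U" using \<open>a \<in> U\<close> xy T by (auto simp: transpose_def)
      show "z (?t a) (\<sigma> (?t a)) = z a ((\<sigma> \<circ> ?t) a)"
        using xy by (auto simp: transpose_def)
    qed (use xy T in \<open>auto simp: transpose_def\<close>)
    ultimately show "of_int (sign (\<sigma> \<circ> ?t)) * (\<Prod>t\<in>U. z t ((\<sigma> \<circ> ?t) t)) =
        - (of_int (sign \<sigma>) * (\<Prod>t\<in>U. z t (\<sigma> t)))" by simp
  qed
  finally have eq: "?S = - ?S" by (simp add: sum_negf)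
  show ?thesis
  proof (rule poly_mapping_eqI)
    fix m
    have "Poly_Mapping.lookup ?S m = - Poly_Mapping.lookup ?S m"
      using arg_cong[OF eq, of "\<lambda>p. Poly_Mapping.lookup p m"] by simp
    then show "Poly_Mapping.lookup ?S m = Poly_Mapping.lookup 0 m" by simp
  qed
qed

text \<open>The Garnir relation. The word \<open>u = a @ b\<close> contains two columns, and \<open>{i..p + i}\<close> is the stretch from
  the \<open>i\<close>-th position of the first column to the \<open>i\<close>-th position of the second one. These are \<open>p + 1\<close>
  positions, while only \<open>p\<close> rows are involved. After expanding both minors, each pair of row
  assignments uses one row twice, and its contribution vanishes.\<close>

lemma garnir_sum:
  assumes "i < length b" "i < length a" "length b \<le> length a"
  defines "u \<equiv> a @ b" and "p \<equiv> length a"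
  shows "(\<Sum>\<sigma> | \<sigma> permutes {i..p + i}. of_int (sign \<sigma>) *
     (minor (take p (permute_list \<sigma> u)) * minor (drop p (permute_list \<sigma> u)))) = 0"
proof -
  let ?q = "length b"
  let ?T = "{i..p + i}" and ?U = "{0..<p + ?q}"
  define row where "row = (\<lambda>\<tau> \<rho> t. if t < p then \<tau> t else \<rho> (t - p) :: nat)"
  define V where "V = (\<lambda>\<tau> \<rho> t s. Var (row \<tau> \<rho> t + 1, u ! s) :: (nat \<times> nat) cpoly)"
  have lenu: "length u = p + ?q" by (simp add: u_def p_def)
  have TU: "?T \<subseteq> ?U" using assms by auto
  have exp: "minor (take p (permute_list \<sigma> u)) * minor (drop p (permute_list \<sigma> u)) =
     (\<Sum>\<tau> | \<tau> permutes {0..<p}. \<Sum>\<rho> | \<rho> permutes {0..<?q}. of_int (sign \<tau>) * of_int (sign \<rho>)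
        * (\<Prod>t\<in>?U. V \<tau> \<rho> t (\<sigma> t)))" if "\<sigma> permutes ?T" for \<sigma>
  proof -
    have \<sigma>: "\<sigma> permutes {..<length u}"
      by (rule permutes_subset[OF that]) (use TU in \<open>auto simp: u_def p_def\<close>)
    have len: "length (take p (permute_list \<sigma> u)) = p" "length (drop p (permute_list \<sigma> u)) = ?q"
      by (auto simp: u_def p_def)
    have pr: "(\<Prod>c = 0..<p. Var (\<tau> c + 1, take p (permute_list \<sigma> u) ! c)) *
       (\<Prod>c = 0..<?q. Var (\<rho> c + 1, drop p (permute_list \<sigma> u) ! c)) = (\<Prod>t\<in>?U. V \<tau> \<rho> t (\<sigma> t))" for \<tau> \<rho>
    proof -
      have "(\<Prod>t\<in>?U. V \<tau> \<rho> t (\<sigma> t)) = (\<Prod>t = 0..<p. V \<tau> \<rho> t (\<sigma> t)) * (\<Prod>t = p..<p+?q. V \<tau> \<rho> t (\<sigma> t))"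
        by (simp add: prod.atLeastLessThan_concat)
      also have "(\<Prod>t = p..<p+?q. V \<tau> \<rho> t (\<sigma> t)) = (\<Prod>c = 0..<?q. V \<tau> \<rho> (c + p) (\<sigma> (c + p)))"
        using prod.shift_bounds_nat_ivl[of _ 0 p ?q] by (simp add: add.commute)
      also have "\<dots> = (\<Prod>c = 0..<?q. Var (\<rho> c + 1, drop p (permute_list \<sigma> u) ! c))"
        by (intro prod.cong refl)
          (simp add: V_def row_def permute_list_nth[OF \<sigma>] lenu add.commute)
      also have "(\<Prod>t = 0..<p. V \<tau> \<rho> t (\<sigma> t)) = (\<Prod>c = 0..<p. Var (\<tau> c + 1, take p (permute_list \<sigma> u) ! c))"
        by (intro prod.cong refl)
          (simp add: V_def row_def permute_list_nth[OF \<sigma>] lenu)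
      finally show ?thesis by simp
    qed
    have "minor (take p (permute_list \<sigma> u)) * minor (drop p (permute_list \<sigma> u)) =
      (\<Sum>\<tau> | \<tau> permutes {0..<p}. \<Sum>\<rho> | \<rho> permutes {0..<?q}.
         (of_int (sign \<tau>) * (\<Prod>c = 0..<p. Var (\<tau> c + 1, take p (permute_list \<sigma> u) ! c))) *
         (of_int (sign \<rho>) * (\<Prod>c = 0..<?q. Var (\<rho> c + 1, drop p (permute_list \<sigma> u) ! c))))"
      unfolding minor_expand len by (rule sum_product)
    also have "\<dots> = (\<Sum>\<tau> | \<tau> permutes {0..<p}. \<Sum>\<rho> | \<rho> permutes {0..<?q}. of_int (sign \<tau>) * of_int (sign \<rho>)
        * (\<Prod>t\<in>?U. V \<tau> \<rho> t (\<sigma> t)))"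
      by (intro sum.cong refl) (simp only: pr[symmetric] mult_ac)
    finally show ?thesis .
  qed
  have zero: "(\<Sum>\<sigma> | \<sigma> permutes ?T. of_int (sign \<sigma>) * (\<Prod>t\<in>?U. V \<tau> \<rho> t (\<sigma> t))) = 0"
    if \<tau>: "\<tau> permutes {0..<p}" and \<rho>: "\<rho> permutes {0..<?q}" for \<tau> \<rho>
  proof -
    have "row \<tau> \<rho> t < p" if "t \<in> ?T" for t
    proof (cases "t < p")
      case False
      then have "t - p < ?q" using that assms by auto
      then show ?thesis using permutes_nat_less[OF \<rho>] False assms(3) by (fastforce simp: row_def p_def)
    qed (use permutes_nat_less[OF \<tau>] in \<open>simp add: row_def\<close>)
    then have "row \<tau> \<rho> ` ?T \<subseteq> {0..<p}" by auto
    then have "card (row \<tau> \<rho> ` ?T) \<le> card {0..<p}" by (intro card_mono) simp_all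
    then have "card (row \<tau> \<rho> ` ?T) < card ?T" by simp
    then obtain x y where "x \<in> ?T" "y \<in> ?T" "x \<noteq> y" "row \<tau> \<rho> x = row \<tau> \<rho> y"
      using pigeonhole[of "row \<tau> \<rho>" ?T] by (auto simp: inj_on_def)
    then show ?thesis by (intro alternating_sum_eq_0[of _ _ x y] TU) (auto simp: V_def)
  qed
  have "(\<Sum>\<sigma> | \<sigma> permutes ?T. of_int (sign \<sigma>) *
     (minor (take p (permute_list \<sigma> u)) * minor (drop p (permute_list \<sigma> u)))) =
     (\<Sum>\<sigma> | \<sigma> permutes ?T. \<Sum>\<tau> | \<tau> permutes {0..<p}. \<Sum>\<rho> | \<rho> permutes {0..<?q}.
        of_int (sign \<tau>) * of_int (sign \<rho>) * (of_int (sign \<sigma>) * (\<Prod>t\<in>?U. V \<tau> \<rho> t (\<sigma> t))))"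
    by (intro sum.cong refl, clarify, subst exp, assumption, simp only: sum_distrib_left mult_ac)
  also have "\<dots> = (\<Sum>\<tau> | \<tau> permutes {0..<p}. \<Sum>\<rho> | \<rho> permutes {0..<?q}. of_int (sign \<tau>) * of_int (sign \<rho>) *
       (\<Sum>\<sigma> | \<sigma> permutes ?T. of_int (sign \<sigma>) * (\<Prod>t\<in>?U. V \<tau> \<rho> t (\<sigma> t))))"
    by (subst sum.swap, rule sum.cong[OF refl], subst sum.swap, simp add: sum_distrib_left)
  also have "\<dots> = 0" by (simp add: zero)
  finally show ?thesis .
qed

lemma minor_permute_left:
  assumes s: "s permutes {..<p}" and "p \<le> length u"
  shows "minor (take p (permute_list s u)) = of_int (sign s) * minor (take p u)"
    and "drop p (permute_list s u) = drop p u"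
proof -
  have s': "s permutes {..<length u}" using s assms(2) by (rule_tac permutes_subset[OF s]) auto
  have "take p (permute_list s u) = permute_list s (take p u)"
  proof (rule nth_equalityI)
    fix i assume "i < length (take p (permute_list s u))"
    then have i: "i < p" "i < length u" using assms by auto
    then have "s i < p" using permutes_in_image[OF s, of i] by auto
    then show "take p (permute_list s u) ! i = permute_list s (take p u) ! i"
      using i s assms(2) by (simp add: permute_list_nth[OF s'] permute_list_nth min_absorb2)
  qed simp
  then show "minor (take p (permute_list s u)) = of_int (sign s) * minor (take p u)"
    using minor_permute_list[of s "take p u"] assms by (simp add: min_absorb2)
  show "drop p (permute_list s u) = drop p u"
    by (rule nth_equalityI) (use s' in \<open>auto simp: permute_list_nth permutes_not_in[OF s]\<close>)
qed

lemma minor_permute_right: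
  assumes s: "s permutes {p..<length u}" and "p \<le> length u"
  shows "minor (drop p (permute_list s u)) = of_int (sign s) * minor (drop p u)"
    and "take p (permute_list s u) = take p u"
proof -
  let ?A = "{p..<length u}" and ?f = "\<lambda>x. x - p"
  have s': "s permutes {..<length u}" by (rule permutes_subset[OF s]) auto
  have inj: "inj_on ?f ?A" by (auto simp: inj_on_def)
  have im: "?f ` ?A = {..<length u - p}"
    by (auto simp: image_iff) (metis add.commute add_diff_cancel_left' atLeastLessThan_iff le_add2 less_diff_conv)
  define t where "t = map_permutation ?A ?f s"
  have t: "t permutes {..<length (drop p u)}"
    using map_permutation_permutes[OF inj_on_imp_bij_betw[OF inj] s] unfolding t_def im by simp
  have st: "sign t = sign s" unfolding t_def by (rule sign_map_permutation[OF inj s]) simp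
  have "drop p (permute_list s u) = permute_list t (drop p u)"
  proof (rule nth_equalityI)
    fix i assume "i < length (drop p (permute_list s u))"
    then have i: "p + i < length u" by simp
    have "t (?f (p + i)) = ?f (s (p + i))"
      unfolding t_def by (rule map_permutation_apply[OF inj]) (use i in auto)
    moreover have "p \<le> s (p + i)" using permutes_in_image[OF s, of "p + i"] i by auto
    moreover have "t i < length u - p" using permutes_in_image[OF t, of i] i by auto
    ultimately show "drop p (permute_list s u) ! i = permute_list t (drop p u) ! i"
      using i by (simp add: permute_list_nth[OF s'] permute_list_nth[OF t])
  qed simp
  then show "minor (drop p (permute_list s u)) = of_int (sign s) * minor (drop p u)"
    using minor_permute_list[OF t] st by simp
  show "take p (permute_list s u) = take p u"
    by (rule nth_equalityI) (use s' assms in \<open>auto simp: permute_list_nth permutes_not_in[OF s]\<close>)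
qed

text \<open>A permutation that preserves the two halves of the stretch only permutes the entries inside each
  column, so its summand in the Garnir relation is the product one started with.\<close>

lemma garnir_block_term:
  assumes \<sigma>: "\<sigma> permutes {i..p + i}" and im: "\<sigma> ` {i..<p} = {i..<p}"
    and u: "p + i < length u" and ip: "i < p"
  shows "of_int (sign \<sigma>) * (minor (take p (permute_list \<sigma> u)) * minor (drop p (permute_list \<sigma> u)))
     = minor (take p u) * minor (drop p u)"
proof -
  \<comment> \<open>The signs of the permutations of the two halves cancel against the sign of \<open>\<sigma>\<close>.\<close>
  define s where "s = (\<lambda>x. if x \<in> {i..<p} then \<sigma> x else x)"
  define t where "t = (\<lambda>x. if x \<in> {p..p + i} then \<sigma> x else x)"
  have inj: "inj \<sigma>" using permutes_inj[OF \<sigma>] .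
  have im': "\<sigma> ` {p..p + i} = {p..p + i}"
  proof -
    have "{p..p + i} = {i..p + i} - {i..<p}" using ip by auto
    then show ?thesis using permutes_image[OF \<sigma>] im inj by (simp add: image_set_diff)
  qed
  have s: "s permutes {i..<p}"
    by (rule bij_imp_permutes) (use im inj in \<open>auto simp: s_def bij_betw_def inj_on_def inj_def\<close>)
  have t: "t permutes {p..p + i}"
    by (rule bij_imp_permutes) (use im' inj in \<open>auto simp: t_def bij_betw_def inj_on_def inj_def\<close>)
  have st: "\<sigma> = s \<circ> t"
  proof
    fix x
    show "\<sigma> x = (s \<circ> t) x"
    proof (cases "x \<in> {p..p + i}")
      case True
      then have "\<sigma> x \<in> {p..p + i}" using im' by blast
      then show ?thesis using True by (auto simp: s_def t_def)
    next
      case False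
      then show ?thesis using permutes_not_in[OF \<sigma>, of x] by (auto simp: s_def t_def)
    qed
  qed
  have s': "s permutes {..<p}" by (rule permutes_subset[OF s]) auto
  have t': "t permutes {p..<length u}" by (rule permutes_subset[OF t]) (use u in auto)
  have tu: "t permutes {..<length u}" by (rule permutes_subset[OF t]) (use u in auto)
  have su: "s permutes {..<length u}" by (rule permutes_subset[OF s]) (use u in auto)
  have "permutation s" "permutation t" using s' t' permutation_permutes finite_lessThan finite_atLeastLessThan by blast+
  then have sg: "sign \<sigma> = sign s * sign t" unfolding st by (rule sign_compose)
  have pl: "permute_list \<sigma> u = permute_list t (permute_list s u)"
    unfolding st by (rule permute_list_compose[OF tu])
  have "minor (take p (permute_list \<sigma> u)) = of_int (sign s) * minor (take p u)"
    unfolding pl using minor_permute_right(2)[of t p "permute_list s u"] t' u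
      minor_permute_left(1)[OF s', of u] by simp
  moreover have "minor (drop p (permute_list \<sigma> u)) = of_int (sign t) * minor (drop p u)"
    unfolding pl using minor_permute_right(1)[of t p "permute_list s u"] t' u
      minor_permute_left(2)[OF s', of u] by simp
  moreover have "of_int (sign s * sign t) * (of_int (sign s) * x * (of_int (sign t) * y)) = x * y"
    for x y :: "(nat \<times> nat) cpoly"
  proof -
    have "of_int (sign s * sign t) * (of_int (sign s) * x * (of_int (sign t) * y))
       = of_int ((sign s * sign s) * (sign t * sign t)) * (x * y)" by (simp only: of_int_mult mult_ac)
    then show ?thesis by simp
  qed
  ultimately show ?thesis using sg by simp
qed

text \<open>Only the elements that \<open>A\<close> and \<open>B\<close> do not share matter, and there are equally many of them on both
  sides.\<close>

lemma sum_exchange_less: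
  fixes f :: "nat \<Rightarrow> nat"
  assumes "finite A" "finite B" "card A = card B" "A \<noteq> B"
    and "\<And>x. x \<in> A \<Longrightarrow> f x \<le> m" "\<And>x. x \<in> B - A \<Longrightarrow> m < f x"
  shows "sum f A < sum f B"
proof -
  have c: "card (A - B) = card (B - A)" using assms(1-3)
    by (metis card_Diff_subset_Int finite_Int inf_commute)
  have "B - A \<noteq> {}" using assms(1-4) by (metis Diff_eq_empty_iff card_subset_eq)
  then have pos: "card (B - A) > 0" using assms(2) by (simp add: card_gt_0_iff)
  have "sum f (A - B) \<le> card (A - B) * m" using sum_bounded_above[of "A - B" f m] assms(5) by auto
  also have "\<dots> < card (B - A) * (m + 1)" using c pos by simp
  also have "\<dots> \<le> sum f (B - A)" using sum_bounded_below[of "B - A" "m + 1" f] assms(6) by fastforce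
  finally have "sum f (A - B) < sum f (B - A)" .
  moreover have "sum f A = sum f (A - B) + sum f (A \<inter> B)" "sum f B = sum f (B - A) + sum f (A \<inter> B)"
    using sum.Int_Diff[OF assms(1), of f B] sum.Int_Diff[OF assms(2), of f A] by (simp_all add: Int_commute)
  ultimately show ?thesis by simp
qed

lemma scale_of_int: "of_int e * p = scale_cpoly (of_int e) p"
  by (simp add: scale_cpoly_def of_int_eq_Const)

text \<open>A violation \<open>a ! i < b ! i\<close> means that the first \<open>i + 1\<close> entries of \<open>b\<close> all exceed the entries of \<open>a\<close> from
  position \<open>i\<close> on. So every summand of the Garnir relation that is not block-preserving moves
  larger entries into the first column. The block-preserving summands are all equal to
  \<open>minor a * minor b\<close>, and their number is invertible.\<close>

lemma garnir_straightening:
  assumes a: "is_col n a" and b: "is_col n b" and len: "length b \<le> length a"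
    and i: "i < length b" and less: "a ! i < b ! i"
  shows "minor a * minor b \<in> cpoly.span {minor a' * minor b' | a' b'. is_col n a' \<and> is_col n b' \<and>
     length a' = length a \<and> length b' = length b \<and> sum_list a < sum_list a' \<and>
     sum_list a' + sum_list b' = sum_list a + sum_list b}" (is "_ \<in> cpoly.span ?S")
proof -
  define u p where "u = a @ b" and "p = length a"
  have ip: "i < p" using i len by (simp add: p_def)
  have lenu: "length u = p + length b" by (simp add: u_def p_def)
  let ?T = "{i..p + i}"
  define F where "F = (\<lambda>\<sigma>. of_int (sign \<sigma>) *
     (minor (take p (permute_list \<sigma> u)) * minor (drop p (permute_list \<sigma> u))))"
  let ?P = "{\<sigma>. \<sigma> permutes ?T}" and ?K = "{\<sigma>. \<sigma> permutes ?T \<and> \<sigma> ` {i..<p} = {i..<p}}"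
  have fin: "finite ?P" by (simp add: finite_permutations)
  have u_a: "u ! x = a ! x" if "x < p" for x using that by (simp add: u_def p_def nth_append)
  have u_b: "u ! x = b ! (x - p)" if "p \<le> x" for x using that by (simp add: u_def p_def nth_append)
  have K: "F \<sigma> = minor a * minor b" if "\<sigma> \<in> ?K" for \<sigma>
    using garnir_block_term[of \<sigma> i p u] that i ip lenu unfolding F_def by (simp add: u_def p_def)
  have N: "F \<sigma> \<in> cpoly.span ?S" if "\<sigma> \<in> ?P - ?K" for \<sigma>
  proof -
    from that have \<sigma>: "\<sigma> permutes ?T" and im: "\<sigma> ` {i..<p} \<noteq> {i..<p}" by auto
    have \<sigma>u: "\<sigma> permutes {..<length u}" by (rule permutes_subset[OF \<sigma>]) (use i lenu in auto)
    define v where "v = permute_list \<sigma> u"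
    have lenv: "length v = p + length b" and msv: "mset v = mset u"
      using lenu \<sigma>u by (auto simp: v_def)
    have nthv: "v ! x = u ! \<sigma> x" if "x < length u" for x
      unfolding v_def using that by (rule permute_list_nth[OF \<sigma>u])
    have inj: "inj_on \<sigma> A" for A using permutes_inj[OF \<sigma>] by (rule inj_on_subset) simp
    show ?thesis
    proof (cases "distinct (take p v) \<and> distinct (drop p v)")
      case False
      then have "F \<sigma> = 0" unfolding F_def v_def[symmetric] using minor_not_distinct by auto
      then show ?thesis by (simp add: cpoly.span_zero)
    next
      case True
      let ?a = "rev (sort (take p v))" and ?b = "rev (sort (drop p v))"
      obtain e f where ef: "minor (take p v) = of_int e * minor ?a" "minor (drop p v) = of_int f * minor ?b"
        using minor_sorted_column by meson
      have "set v \<subseteq> {1..n}" using a b mset_eq_setD[OF msv] by (auto simp: u_def is_col_def)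
      then have "set (take p v) \<subseteq> {1..n}" "set (drop p v) \<subseteq> {1..n}"
        using set_take_subset[of p v] set_drop_subset[of p v] by blast+
      with True have cols: "is_col n ?a" "is_col n ?b" by (blast intro: is_colI)+
      have sl: "sum_list (rev (sort xs)) = sum_list xs" for xs :: "nat list"
        by (metis mset_rev mset_sort sum_mset_sum_list)
      have "sum_list v = sum_list u" using msv by (metis sum_mset_sum_list)
      moreover have "sum_list v = sum_list (take p v) + sum_list (drop p v)"
        by (metis append_take_drop_id sum_list_append)
      ultimately have tot: "sum_list ?a + sum_list ?b = sum_list a + sum_list b"
        unfolding sl by (simp add: u_def)
      have split: "(\<Sum>x = 0..<p. g x) = (\<Sum>x = 0..<i. g x) + (\<Sum>x = i..<p. g x)" for g :: "nat \<Rightarrow> nat"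
        using ip by (simp add: sum.atLeastLessThan_concat)
      have "sum_list a = (\<Sum>x = 0..<p. u ! x)" by (simp add: sum_list_sum_nth p_def[symmetric] u_a)
      also have "\<dots> = (\<Sum>x = 0..<i. u ! x) + (\<Sum>x = i..<p. u ! x)" by (rule split)
      also have "(\<Sum>x = i..<p. u ! x) < (\<Sum>x\<in>\<sigma> ` {i..<p}. u ! x)"
      proof (rule sum_exchange_less[where m = "a ! i"])
        show "card {i..<p} = card (\<sigma> ` {i..<p})" by (simp add: card_image inj)
        show "u ! x \<le> a ! i" if "x \<in> {i..<p}" for x
          using that a unfolding is_col_def sorted_wrt_iff_nth_less
          by (cases "x = i") (auto simp: u_a p_def less_imp_le)
        show "a ! i < u ! x" if "x \<in> \<sigma> ` {i..<p} - {i..<p}" for x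
        proof -
          from that obtain y where "y \<in> {i..<p}" "x = \<sigma> y" "x \<notin> {i..<p}" by blast
          moreover have "y \<in> ?T" using \<open>y \<in> {i..<p}\<close> by auto
          ultimately have "x \<in> ?T" "x \<notin> {i..<p}" using permutes_in_image[OF \<sigma>, of y] by auto
          then have x: "p \<le> x" "x - p \<le> i" by auto
          then have "b ! i \<le> b ! (x - p)" using b i unfolding is_col_def sorted_wrt_iff_nth_less
            by (cases "x - p = i") (auto simp: less_imp_le)
          then show ?thesis using less x by (simp add: u_b)
        qed
      qed (use im in auto)
      also have "(\<Sum>x\<in>\<sigma> ` {i..<p}. u ! x) = (\<Sum>x = i..<p. v ! x)"
        by (subst sum.reindex[OF inj]) (auto intro!: sum.cong simp: nthv lenu)
      also have "(\<Sum>x = 0..<i. u ! x) = (\<Sum>x = 0..<i. v ! x)"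
        by (rule sum.cong) (use ip in \<open>auto simp: nthv lenu permutes_not_in[OF \<sigma>]\<close>)
      also have "(\<Sum>x = 0..<i. v ! x) + (\<Sum>x = i..<p. v ! x) = (\<Sum>x = 0..<p. v ! x)" by (rule split[symmetric])
      also have "\<dots> = sum_list (take p v)" by (simp add: sum_list_sum_nth lenv)
      finally have "sum_list a < sum_list ?a" by (simp only: sl)
      then have mem: "minor ?a * minor ?b \<in> ?S"
        using cols tot by (intro CollectI exI[of _ ?a] exI[of _ ?b]) (simp add: lenv p_def)
      have "F \<sigma> = scale_cpoly (of_int (sign \<sigma> * e * f)) (minor ?a * minor ?b)"
        unfolding F_def v_def[symmetric] ef scale_of_int[symmetric] by (simp add: mult_ac)
      then show ?thesis using cpoly.span_scale[OF cpoly.span_base[OF mem]] by (simp only:)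
    qed
  qed
  \<comment> \<open>\<open>N\<close> is nonzero, so the relation can be solved for the product over \<open>a\<close> and \<open>b\<close>.\<close>
  define N where "N = card ?K"
  have "finite ?K" by (rule finite_subset[OF _ fin]) auto
  moreover have "id \<in> ?K" by (simp add: permutes_id)
  ultimately have "N \<noteq> 0" unfolding N_def by (metis card_0_eq empty_iff)
  have "0 = sum F ?P" using garnir_sum[of i b a] i ip len unfolding F_def u_def p_def by simp
  also have "\<dots> = sum F ?K + sum F (?P - ?K)"
    by (subst sum.subset_diff[of ?K]) (use fin in \<open>auto simp: add.commute\<close>)
  also have "sum F ?K = of_nat N * (minor a * minor b)" using K by (simp add: N_def)
  finally have "of_nat N * (minor a * minor b) = - sum F (?P - ?K)"
    by (simp add: eq_neg_iff_add_eq_0)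
  moreover have "- sum F (?P - ?K) \<in> cpoly.span ?S" by (intro cpoly.span_neg cpoly.span_sum N)
  moreover have "of_nat N * (minor a * minor b) = scale_cpoly (of_nat N) (minor a * minor b)"
    using scale_of_int[of "int N"] by simp
  ultimately have "scale_cpoly (of_nat N) (minor a * minor b) \<in> cpoly.span ?S" by (simp only:)
  then have "scale_cpoly (1 / of_nat N) (scale_cpoly (of_nat N) (minor a * minor b)) \<in> cpoly.span ?S"
    by (rule cpoly.span_scale)
  then show ?thesis using \<open>N \<noteq> 0\<close> by (simp only: cpoly.scale_scale) simp
qed

text \<open>The classical semistandardness condition for two columns, each listed
  decreasingly.\<close>

definition col_ge :: "nat list \<Rightarrow> nat list \<Rightarrow> bool" where
  "col_ge a b \<longleftrightarrow> length b \<le> length a \<and> (\<forall>i<length b. b ! i \<le> a ! i)"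

lemma span_mult_right:
  assumes "x \<in> cpoly.span S" "\<And>s. s \<in> S \<Longrightarrow> s * r \<in> cpoly.span T"
  shows "x * r \<in> cpoly.span T"
  using assms(1)
proof (induction rule: cpoly.span_induct_alt)
  case base
  show ?case by (simp add: cpoly.span_zero)
next
  case (step c s y)
  then show ?case
    by (simp add: distrib_right scale_cpoly_mult(1)[symmetric] cpoly.span_add cpoly.span_scale assms(2))
qed

text \<open>Transferring an amount from the smaller to the larger of two numbers increases the sum of squares;
  this lets straightening terminate.\<close>

lemma square_exchange_less:
  fixes x y' d :: nat
  assumes "y' + d \<le> x" "0 < d"
  shows "x^2 + (y' + d)^2 < (x + d)^2 + y'^2"
proof -
  have "y' < x" using assms by simp
  then have "y' * d < x * d" "d * y' < d * x" using assms by simp_all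
  then show ?thesis unfolding power2_eq_square distrib_left distrib_right by linarith
qed

lemma is_col_bounds:
  assumes "is_col n c"
  shows "length c \<le> n" "sum_list c \<le> n * n"
proof -
  have d: "distinct c" using assms unfolding is_col_def
    by (metis distinct_rev sorted_wrt_rev strict_sorted_iff sorted_wrt_mono_rel)
  have "length c = card (set c)" using d by (simp add: distinct_card)
  also have "\<dots> \<le> card {1..n}" using assms by (intro card_mono) (auto simp: is_col_def)
  finally show l: "length c \<le> n" by simp
  have "\<forall>x\<in>set c. x \<le> n" using assms by (auto simp: is_col_def)
  then have "sum_list c \<le> length c * n" by (induction c) auto
  also have "\<dots> \<le> n * n" using l by simp
  finally show "sum_list c \<le> n * n" .
qed

text \<open>Sort the columns by \<open>f c\<close>, where the length of \<open>c\<close> dominates the sum of its entries. If the sorted list is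
  not a chain, then straightening a violating pair moves some amount of \<open>f\<close> from the column with the
  smaller to the one with the larger value. This increases the sum \<open>\<Phi>\<close> of the squares of \<open>f\<close>, which is bounded.\<close>

lemma column_straightening:
  assumes "\<And>c. c \<in># M \<Longrightarrow> is_col n c \<and> length c \<in> D"
  shows "(\<Prod>c\<in>#M. minor c) \<in> cpoly.span {\<Prod>c\<leftarrow>Y. minor c | Y.
     length Y = size M \<and> (\<forall>c\<in>set Y. is_col n c \<and> length c \<in> D) \<and> sorted_wrt col_ge Y}"
proof -
  \<comment> \<open>Sums of entries of a column are at most \<open>n * n\<close>, so \<open>f\<close> compares lengths first.\<close>
  define f where "f = (\<lambda>c. (n * n + 1) * length c + sum_list c :: nat)"
  define \<Phi> where "\<Phi> = (\<lambda>M. \<Sum>c\<in>#M. f c ^ 2)"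
  define E where "E = ((n * n + 1) * n + n * n)^2"
  have fE: "f c ^ 2 \<le> E" if "is_col n c" for c
    unfolding E_def f_def using is_col_bounds[OF that]
    by (intro power_mono add_mono mult_left_mono) auto
  have bound: "\<Phi> M \<le> size M * E" if "\<And>c. c \<in># M \<Longrightarrow> is_col n c" for M
    using that unfolding \<Phi>_def by (induction M) (auto intro!: add_mono fE)
  show ?thesis using assms
  proof (induction "size M * E - \<Phi> M" arbitrary: M rule: less_induct)
    case less
    let ?S = "\<lambda>m. {\<Prod>c\<leftarrow>Y. minor c | Y.
     length Y = m \<and> (\<forall>c\<in>set Y. is_col n c \<and> length c \<in> D) \<and> sorted_wrt col_ge Y}"
    obtain Y0 where "mset Y0 = M" using ex_mset by blast
    define Y where "Y = rev (sort_key f Y0)"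
    have Y: "mset Y = M" using \<open>mset Y0 = M\<close> by (simp add: Y_def)
    have srt: "sorted_wrt (\<lambda>a b. f b \<le> f a) Y"
      using sorted_sort_key[of f Y0] by (simp add: Y_def sorted_wrt_rev sorted_wrt_map)
    have setY: "set Y = set_mset M" using Y by auto
    have prodY: "(\<Prod>c\<in>#M. minor c) = (\<Prod>c\<leftarrow>Y. minor c)"
      unfolding Y[symmetric] by (metis mset_map prod_mset_prod_list)
    show ?case
    proof (cases "sorted_wrt col_ge Y")
      case True
      have "(\<Prod>c\<in>#M. minor c) \<in> ?S (size M)"
        unfolding prodY using True less.prems Y setY
        by (intro CollectI exI[of _ Y]) (auto simp flip: size_mset)
      then show ?thesis by (rule cpoly.span_base)
    next
      case False
      then obtain i j where ij: "i < j" "j < length Y" "\<not> col_ge (Y ! i) (Y ! j)"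
        by (auto simp: sorted_wrt_iff_nth_less)
      define a b where "a = Y ! i" and "b = Y ! j"
      have f: "f b \<le> f a" using srt ij unfolding sorted_wrt_iff_nth_less a_def b_def by auto
      obtain Z where M: "M = add_mset a (add_mset b Z)"
      proof -
        have "Y = take i Y @ a # drop (Suc i) Y" using ij by (simp add: a_def id_take_nth_drop)
        moreover have "b \<in> set (drop (Suc i) Y)" unfolding b_def in_set_conv_nth
          using ij by (intro exI[of _ "j - Suc i"]) auto
        then obtain Z' where "mset (drop (Suc i) Y) = add_mset b Z'"
          by (metis set_mset_mset mset_add)
        ultimately have "mset Y = add_mset a (add_mset b (mset (take i Y) + Z'))"
          by (metis mset.simps(2) mset_append union_mset_add_mset_right)
        then show ?thesis using that Y by simp
      qed
      have ab: "is_col n a" "is_col n b" "length a \<in> D" "length b \<in> D"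
        using less.prems unfolding M by auto
      have len: "length b \<le> length a"
      proof (rule ccontr)
        assume "\<not> length b \<le> length a"
        then have "(n * n + 1) * (length a + 1) \<le> (n * n + 1) * length b" by (intro mult_left_mono) auto
        then have "f a < f b" using is_col_bounds(2)[OF ab(1)] unfolding f_def by simp
        then show False using f by simp
      qed
      with ij(3) obtain k where k: "k < length b" "a ! k < b ! k"
        unfolding col_ge_def a_def[symmetric] b_def[symmetric] by auto
      have "(minor a * minor b) * (\<Prod>c\<in>#Z. minor c) \<in> cpoly.span (?S (size M))"
      proof (rule span_mult_right[OF garnir_straightening[OF ab(1,2) len k]])
        fix s assume "s \<in> {minor a' * minor b' |a' b'. is_col n a' \<and> is_col n b' \<and>
          length a' = length a \<and> length b' = length b \<and> sum_list a < sum_list a' \<and>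
          sum_list a' + sum_list b' = sum_list a + sum_list b}"
        then obtain a' b' where s: "s = minor a' * minor b'" and a': "is_col n a'" "length a' = length a"
          and b': "is_col n b'" "length b' = length b" and sl: "sum_list a < sum_list a'"
          "sum_list a' + sum_list b' = sum_list a + sum_list b" by blast
        define M' where "M' = add_mset a' (add_mset b' Z)"
        define d where "d = sum_list a' - sum_list a"
        have d: "f a' = f a + d" "f b = f b' + d" "0 < d"
          using sl a' b' by (auto simp: d_def f_def)
        have "\<Phi> M < \<Phi> M'" using square_exchange_less[of "f b'" d "f a"] d f
          by (simp add: \<Phi>_def M M'_def)
        moreover have M': "is_col n c \<and> length c \<in> D" if "c \<in># M'" for c
          using that less.prems[of c] a' b' ab unfolding M M'_def by auto
        moreover have sz: "size M' = size M" by (simp add: M M'_def)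
        moreover have "\<Phi> M' \<le> size M' * E" by (rule bound) (use M' in blast)
        ultimately have "size M' * E - \<Phi> M' < size M * E - \<Phi> M" by simp
        from less.hyps[OF this M'] have "(\<Prod>c\<in>#M'. minor c) \<in> cpoly.span (?S (size M'))" .
        moreover have "s * (\<Prod>c\<in>#Z. minor c) = (\<Prod>c\<in>#M'. minor c)" by (simp add: s M'_def mult.assoc)
        ultimately show "s * (\<Prod>c\<in>#Z. minor c) \<in> cpoly.span (?S (size M))" unfolding sz by simp
      qed
      then show ?thesis by (simp add: M mult.assoc)
    qed
  qed
qed

section \<open>The permutations attached to order ideals\<close>

lemma foldr_comp_append: "foldr (\<circ>) (xs @ ys) id = foldr (\<circ>) xs id \<circ> foldr (\<circ>) ys id"
  by (induction xs) (simp_all add: comp_assoc)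

lemma foldr_Cons_apply: "foldr f (x # xs) a = f x (foldr f xs a)"
  by simp

lemma foldr_comp_concat:
  "foldr (\<circ>) (concat (map h xs)) id = foldr (\<circ>) (map (\<lambda>x. foldr (\<circ>) (h x) id) xs) id"
proof (induction xs)
  case (Cons x xs)
  have "foldr (\<circ>) (concat (map h (x # xs))) id = foldr (\<circ>) (h x @ concat (map h xs)) id" by simp
  also have "\<dots> = foldr (\<circ>) (h x) id \<circ> foldr (\<circ>) (concat (map h xs)) id" by (rule foldr_comp_append)
  finally show ?case by (simp only: Cons.IH list.map foldr_Cons_apply)
qed simp

lemma foldr_comp_permutes: "(\<And>f. f \<in> set fs \<Longrightarrow> f permutes S) \<Longrightarrow> foldr (\<circ>) fs id permutes S"
  by (induction fs) (auto simp: permutes_id intro: permutes_compose)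

text \<open>The contribution of row \<open>i\<close> to \<open>w_perm\<close>, restricted to the columns up to \<open>N\<close> so that it can be
  evaluated by induction on \<open>N\<close>.\<close>

definition row_perm :: "(nat \<times> nat) set \<Rightarrow> nat \<Rightarrow> nat \<Rightarrow> nat \<Rightarrow> nat" where
  "row_perm M N i = foldr (\<circ>) [Transposition.transpose i j. j \<leftarrow> [i..<Suc N], (i, j) \<in> M] id"

text \<open>The product of the contributions of the rows above row \<open>j\<close>.\<close>

definition upper_rows :: "(nat \<times> nat) set \<Rightarrow> nat \<Rightarrow> nat \<Rightarrow> nat \<Rightarrow> nat" where
  "upper_rows M n j = foldr (\<circ>) (map (row_perm M n) [1..<j]) id"

text \<open>The last entry of row \<open>i\<close> of \<open>M\<close> strictly before column \<open>x\<close>. The diagonal position \<open>i\<close> counts as an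
  entry even if it is not in \<open>M\<close>, because \<open>s\<^bsub>i,i\<^esub>\<close> is the identity.\<close>

definition prev_entry :: "(nat \<times> nat) set \<Rightarrow> nat \<Rightarrow> nat \<Rightarrow> nat" where
  "prev_entry M i x = Max (insert i {y. i < y \<and> y < x \<and> (i, y) \<in> M})"

lemma finite_prev: "finite {y. i < y \<and> y < x \<and> (i, y) \<in> (M :: (nat \<times> nat) set)}"
  by (rule finite_subset[of _ "{..<x}"]) auto

lemma prev_entry_ge: "i \<le> prev_entry M i x"
  unfolding prev_entry_def using finite_prev by (intro Max_ge) auto

lemma prev_entry_upper: "i < y \<Longrightarrow> y < x \<Longrightarrow> (i, y) \<in> M \<Longrightarrow> y \<le> prev_entry M i x"
  unfolding prev_entry_def using finite_prev by (intro Max_ge) auto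

lemma prev_entry_cases: "prev_entry M i x = i \<or> i < prev_entry M i x \<and> prev_entry M i x < x \<and> (i, prev_entry M i x) \<in> M"
proof -
  have "prev_entry M i x \<in> insert i {y. i < y \<and> y < x \<and> (i, y) \<in> M}"
    unfolding prev_entry_def using finite_prev by (intro Max_in) auto
  then show ?thesis by blast
qed

lemma prev_entry_less: "i < x \<Longrightarrow> prev_entry M i x < x"
  using prev_entry_cases[of M i x] by auto

lemma prev_entry_cong:
  assumes "\<And>y. i < y \<Longrightarrow> y < x \<and> (i, y) \<in> M \<longleftrightarrow> y < x' \<and> (i, y) \<in> M'"
  shows "prev_entry M i x = prev_entry M' i x'"
proof -
  have "{y. i < y \<and> y < x \<and> (i, y) \<in> M} = {y. i < y \<and> y < x' \<and> (i, y) \<in> M'}" using assms by blast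
  then show ?thesis unfolding prev_entry_def by simp
qed

lemma prev_entry_Suc: "i < y \<Longrightarrow> prev_entry M i (Suc y) = (if (i, y) \<in> M then y else prev_entry M i y)"
proof -
  assume "i < y"
  show ?thesis
  proof (cases "(i, y) \<in> M")
    case True
    then have "y \<le> prev_entry M i (Suc y)" using \<open>i < y\<close> by (intro prev_entry_upper) auto
    moreover have "prev_entry M i (Suc y) < Suc y" using \<open>i < y\<close> by (intro prev_entry_less) auto
    ultimately show ?thesis using True by simp
  next
    case False
    then show ?thesis by (auto intro!: prev_entry_cong simp: less_Suc_eq)
  qed
qed

text \<open>With \<open>i = b\<^sub>0 < b\<^sub>1 < \<dots> < b\<^sub>s\<close> the entries of the row, the row permutation is the cycle
  \<open>b\<^sub>s \<mapsto> b\<^bsub>s-1\<^esub> \<mapsto> \<dots> \<mapsto> b\<^sub>0 \<mapsto> b\<^sub>s\<close>.\<close>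

lemma row_perm_eval:
  assumes "i \<le> N"
  shows "row_perm M N i x = (if x = i then prev_entry M i (Suc N)
     else if i < x \<and> x \<le> N \<and> (i, x) \<in> M then prev_entry M i x else x)"
  using assms
proof (induction N arbitrary: x rule: nat_induct_at_least)
  case base
  have "prev_entry M i (Suc i) = i" using prev_entry_cases[of M i "Suc i"] by auto
  then show ?case by (simp add: row_perm_def)
next
  case (Suc N)
  have "row_perm M (Suc N) i = row_perm M N i \<circ> (if (i, Suc N) \<in> M then Transposition.transpose i (Suc N) else id)"
  proof -
    have "[i..<Suc (Suc N)] = [i..<Suc N] @ [Suc N]" using Suc.hyps by simp
    then show ?thesis unfolding row_perm_def
      by (simp add: foldr_comp_append del: foldr_append upt_Suc)
  qed
  then show ?case using Suc prev_entry_Suc[of i "Suc N" M]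
    by (auto simp: transpose_def le_Suc_eq)
qed

lemma row_perm_permutes: "1 \<le> i \<Longrightarrow> row_perm M n i permutes {1..n}"
  unfolding row_perm_def by (rule foldr_comp_permutes) (auto intro!: permutes_swap_id)

lemma upper_rows_permutes: "upper_rows M n j permutes {1..n}"
  unfolding upper_rows_def by (rule foldr_comp_permutes) (use row_perm_permutes in force)

lemma upper_rows_1: "upper_rows M n (Suc 0) = id"
  by (simp add: upper_rows_def)

lemma upper_rows_Suc: "1 \<le> j \<Longrightarrow> upper_rows M n (Suc j) = upper_rows M n j \<circ> row_perm M n j"
  by (simp add: upper_rows_def foldr_comp_append del: foldr_append)

lemma w_perm_upper_rows: "w_perm n M = upper_rows M n (Suc n)"
  unfolding w_perm_def upper_rows_def row_perm_def by (rule foldr_comp_concat)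

text \<open>Rows below row \<open>x\<close> fix \<open>x\<close>, and row \<open>x\<close> sends \<open>x\<close> to its last entry.\<close>

lemma upper_rows_stable:
  assumes "1 \<le> x" "x < j" "j \<le> Suc n"
  shows "upper_rows M n j x = upper_rows M n x (prev_entry M x (Suc n))"
proof -
  have "Suc x \<le> j" using assms by simp
  then have "j \<le> Suc n \<longrightarrow> upper_rows M n j x = upper_rows M n (Suc x) x"
  proof (induction j rule: nat_induct_at_least)
    case (Suc j)
    then show ?case by (auto simp: upper_rows_Suc row_perm_eval)
  qed simp
  then show ?thesis using assms by (auto simp: upper_rows_Suc row_perm_eval)
qed

lemma w_perm_eval: "1 \<le> x \<Longrightarrow> x \<le> n \<Longrightarrow> w_perm n M x = upper_rows M n x (prev_entry M x (Suc n))"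
  unfolding w_perm_upper_rows by (rule upper_rows_stable) auto

text \<open>A walk upwards from column \<open>x\<close> never moves to the right and stays strictly above the diagonal, so it
  only sees the part of \<open>M\<close> described in the last assumption.\<close>

lemma upper_rows_cong:
  assumes "j \<le> x" "x \<le> n"
    and "\<And>i y. 1 \<le> i \<Longrightarrow> i < j \<Longrightarrow> i < y \<Longrightarrow> y \<le> x \<Longrightarrow> (i, y) \<in> M \<longleftrightarrow> (i, y) \<in> M'"
  shows "upper_rows M n j x = upper_rows M' n j x"
  using assms
proof (induction j arbitrary: x)
  case (Suc j)
  show ?case
  proof (cases "j = 0")
    case False
    have r: "row_perm M' n j x = row_perm M n j x"
      using Suc.prems False by (auto simp: row_perm_eval intro!: prev_entry_cong)
    have "j \<le> row_perm M n j x" "row_perm M n j x \<le> x"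
      using Suc.prems prev_entry_ge[of j M x] prev_entry_less[of j x M] by (auto simp: row_perm_eval)
    then have "upper_rows M n j (row_perm M n j x) = upper_rows M' n j (row_perm M n j x)"
      using Suc.prems by (intro Suc.IH) auto
    then show ?thesis using False r by (simp add: upper_rows_Suc)
  qed (simp add: upper_rows_1)
qed (simp add: upper_rows_def)

text \<open>Both branches in the definition of \<open>r\<close> describe the same permutation. For \<open>j \<le> m\<close> the set \<open>M\<close> of the
  principal ideal of \<open>(j, m)\<close> has \<open>(j, m)\<close> as last entry of row \<open>j\<close>, and agrees with \<open>Os\<close> off the diagonal on
  the region seen by the walk from there.\<close>

lemma r_num_upper_rows:
  assumes Os: "Os \<subseteq> pos n - diag n" and j: "1 \<le> j" "j \<le> n" and m: "1 \<le> m" "m \<le> n"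
  shows "r_num n Os j m = upper_rows Os n j m"
proof (cases "j \<le> m")
  case True
  let ?P = "principal_ideal n (j, m)"
  let ?M = "M_OC n Os ?P"
  have mx: "maximal_elems ?P = {(j, m)}"
  proof -
    have top: "(j, m) \<in> ?P" using True j m by (simp add: principal_ideal_def pos_def ple_def)
    have le: "p \<preceq> (j, m)" if "p \<in> ?P" for p using that by (simp add: principal_ideal_def)
    have "q = (j, m)" if "q \<in> ?P" "(j, m) \<preceq> q" for q
      using le[OF that(1)] that(2) by (cases q) (simp add: ple_def)
    then show ?thesis using top le unfolding maximal_elems_def by blast
  qed
  have inP: "(i, y) \<in> ?P \<longleftrightarrow> 1 \<le> i \<and> i \<le> y \<and> y \<le> n \<and> i \<le> j \<and> y \<le> m" for i y
    by (auto simp: principal_ideal_def pos_def ple_def)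
  have inM: "(i, y) \<in> ?M \<longleftrightarrow> (i, y) \<in> ?P \<and> ((i, y) \<in> Os \<or> i = y) \<or> i = j \<and> y = m" for i y
    unfolding M_OC_def mx using inP[of i y] by (auto simp: diag_def)
  have le: "y \<le> m" if "(j, y) \<in> ?M" for y
    using that inM[of j y] inP[of j y] by auto
  have "prev_entry ?M j (Suc n) = m"
  proof (cases "j = m")
    case True
    then show ?thesis using prev_entry_cases[of ?M j "Suc n"] le[of "prev_entry ?M j (Suc n)"] by linarith
  next
    case False
    have "m \<le> prev_entry ?M j (Suc n)"
      using \<open>j \<le> m\<close> False m by (intro prev_entry_upper) (simp_all add: inM)
    then show ?thesis
      using prev_entry_cases[of ?M j "Suc n"] le[of "prev_entry ?M j (Suc n)"] \<open>j \<le> m\<close> False by linarith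
  qed
  then have "r_num n Os j m = upper_rows ?M n j m"
    using True j by (simp add: r_num_def w_ideal_def w_perm_eval)
  also have "\<dots> = upper_rows Os n j m"
    using True m j by (intro upper_rows_cong) (auto simp: inM inP)
  finally show ?thesis .
next
  case False
  then show ?thesis using j m by (simp add: r_num_def w_perm_eval upper_rows_stable)
qed

locale oc_partition =
  fixes n :: nat and Os :: "(nat \<times> nat) set"
  assumes Os: "Os \<subseteq> pos n - diag n"
begin

abbreviation "\<sigma> \<equiv> sigma n Os"
abbreviation "U \<equiv> upper_rows Os n"
abbreviation "w J \<equiv> w_ideal n Os J"
abbreviation "height J \<equiv> card (J \<inter> diag n)"

lemma inj_U: "inj (U j)"
  by (rule permutes_inj[OF upper_rows_permutes])

lemma \<sigma>_eqI:
  assumes "1 \<le> j" "j \<le> n" "x \<in> {1..n}"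
  shows "\<sigma> j (U j x) = x"
proof -
  have eq: "r_num n Os j y = U j y" if "y \<in> {1..n}" for y
    using r_num_upper_rows[OF Os assms(1,2)] that by simp
  have "inj_on (r_num n Os j) {1..n}"
    using inj_U by (auto simp: inj_on_def eq inj_def)
  then have "inv_into {1..n} (r_num n Os j) (r_num n Os j x) = x"
    using assms(3) by (rule inv_into_f_f)
  then show ?thesis using eq[OF assms(3)] by (simp add: sigma_def)
qed

lemma \<sigma>_cases:
  assumes "1 \<le> j" "j \<le> n" "x \<in> {1..n}"
  obtains y where "y \<in> {1..n}" "U j y = x" "\<sigma> j x = y"
proof -
  have "x \<in> U j ` {1..n}" using permutes_image[OF upper_rows_permutes] assms(3) by simp
  then obtain y where y: "y \<in> {1..n}" "x = U j y" by blast
  show ?thesis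
  proof (rule that)
    show "\<sigma> j x = y" unfolding y(2) by (rule \<sigma>_eqI[OF assms(1,2) y(1)])
  qed (use y in simp_all)
qed

lemma \<sigma>_in:
  assumes "1 \<le> j" "j \<le> n" "x \<in> {1..n}"
  shows "\<sigma> j x \<in> {1..n}"
proof -
  obtain y where y: "y \<in> {1..n}" "U j y = x" "\<sigma> j x = y" using \<sigma>_cases[OF assms] .
  show ?thesis unfolding y(3) by (rule y(1))
qed

lemma U_\<sigma>:
  assumes "1 \<le> j" "j \<le> n" "x \<in> {1..n}"
  shows "U j (\<sigma> j x) = x"
proof -
  obtain y where y: "U j y = x" "\<sigma> j x = y" using \<sigma>_cases[OF assms] .
  show ?thesis unfolding y(2) by (rule y(1))
qed

lemma \<sigma>_step:
  assumes "1 \<le> j" "Suc j \<le> n" "x \<in> {1..n}"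
  defines "t \<equiv> \<sigma> (Suc j) x"
  shows "\<sigma> j x = (if t = j then prev_entry Os j (Suc n)
     else if j < t \<and> (j, t) \<in> Os then prev_entry Os j t else t)"
proof -
  have Sj: "1 \<le> Suc j" by simp
  obtain y where y: "y \<in> {1..n}" "U (Suc j) y = x" "\<sigma> (Suc j) x = y"
    using \<sigma>_cases[OF Sj assms(2,3)] .
  have "x = U j (row_perm Os n j y)" using y(2)[symmetric] assms(1) by (simp add: upper_rows_Suc)
  moreover have "row_perm Os n j y \<in> {1..n}"
    using permutes_in_image[OF row_perm_permutes] assms(1) y(1) by simp
  ultimately have "\<sigma> j x = row_perm Os n j y" using \<sigma>_eqI[of j "row_perm Os n j y"] assms by simp
  then show ?thesis using y(1,3) assms(1,2) by (auto simp: row_perm_eval t_def)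
qed

text \<open>Going down from row \<open>j\<close> to row \<open>l\<close>, the position of a value stays, moves to the right or jumps
  to the diagonal. After a jump in row \<open>i\<close> it stays at \<open>i < l\<close>; hence a value whose position in row \<open>l\<close> is at least \<open>l\<close>
  has not jumped.\<close>

lemma \<sigma>_mono:
  assumes "j \<le> l" "1 \<le> j" "l \<le> n" "x \<in> {1..n}" "l \<le> \<sigma> l x"
  shows "j \<le> \<sigma> j x \<and> \<sigma> j x \<le> \<sigma> l x"
  using assms(1,2)
proof (induction j rule: inc_induct)
  case (step i)
  then have IH: "Suc i \<le> \<sigma> (Suc i) x" "\<sigma> (Suc i) x \<le> \<sigma> l x" by auto
  have "\<sigma> i x = (if (i, \<sigma> (Suc i) x) \<in> Os then prev_entry Os i (\<sigma> (Suc i) x) else \<sigma> (Suc i) x)"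
    using \<sigma>_step[of i x] step assms IH by auto
  then show ?case using IH prev_entry_ge[of i Os] prev_entry_less[of i "\<sigma> (Suc i) x" Os] by (auto intro: order.trans less_imp_le)
qed (use assms in simp)

definition row_end :: "(nat \<times> nat) set \<Rightarrow> nat \<Rightarrow> nat" where
  "row_end J j = Max {x. (j, x) \<in> J}"

definition last_entry :: "(nat \<times> nat) set \<Rightarrow> nat \<Rightarrow> nat" where
  "last_entry J j = prev_entry (M_OC n Os J) j (Suc n)"

definition tuple :: "(nat \<times> nat) set \<Rightarrow> nat list" where
  "tuple J = map (w J) [1..<Suc (height J)]"

lemma ideal_pos: "J \<in> order_ideals n \<Longrightarrow> (i, x) \<in> J \<Longrightarrow> 1 \<le> i \<and> i \<le> x \<and> x \<le> n"
  by (auto simp: order_ideals_def pos_def)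

lemma ideal_down:
  "J \<in> order_ideals n \<Longrightarrow> (j, y) \<in> J \<Longrightarrow> 1 \<le> i \<Longrightarrow> i \<le> j \<Longrightarrow> i \<le> x \<Longrightarrow> x \<le> y \<Longrightarrow> (i, x) \<in> J"
  using ideal_pos[of J j y] by (auto simp: order_ideals_def pos_def ple_def)

text \<open>The diagonal elements of an ideal form an initial segment, so the height is the number of
  nonempty rows.\<close>

lemma diag_mem_iff:
  assumes J: "J \<in> order_ideals n"
  shows "(j, j) \<in> J \<longleftrightarrow> 1 \<le> j \<and> j \<le> height J"
proof -
  let ?D = "{i. (i, i) \<in> J}"
  have sub: "?D \<subseteq> {1..n}" using ideal_pos[OF J] by auto
  then have fin: "finite ?D" by (rule finite_subset) simp
  have "J \<inter> diag n = (\<lambda>i. (i, i)) ` ?D" using sub by (auto simp: diag_def)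
  then have h: "height J = card ?D" by (simp add: card_image inj_on_def)
  have "?D = {1..card ?D}"
  proof (cases "?D = {}")
    case False
    define m where "m = Max ?D"
    have m: "(m, m) \<in> J" using Max_in[OF fin False] by (simp add: m_def)
    have "?D = {1..m}"
    proof (rule Set.set_eqI)
      fix i
      show "i \<in> ?D \<longleftrightarrow> i \<in> {1..m}"
        using ideal_pos[OF J, of i i] Max_ge[OF fin, of i] ideal_down[OF J m, of i i]
        by (auto simp: m_def)
    qed
    then show ?thesis by simp
  qed simp
  then have "j \<in> ?D \<longleftrightarrow> j \<in> {1..height J}" unfolding h by (rule arg_cong)
  then show ?thesis by simp
qed

lemma height_le: "J \<in> order_ideals n \<Longrightarrow> height J \<le> n"
  using diag_mem_iff[of J "height J"] ideal_pos[of J "height J" "height J"] by (cases "height J = 0") auto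

lemma mem_height: "J \<in> order_ideals n \<Longrightarrow> (j, x) \<in> J \<Longrightarrow> 1 \<le> j \<and> j \<le> height J"
  using ideal_down[of J j x j j] ideal_pos[of J j x] diag_mem_iff[of J j] by auto

lemma mem_iff_row_end:
  assumes J: "J \<in> order_ideals n" and j: "1 \<le> j" "j \<le> height J"
  shows "(j, x) \<in> J \<longleftrightarrow> j \<le> x \<and> x \<le> row_end J j"
proof -
  have fin: "finite {x. (j, x) \<in> J}" by (rule finite_subset[of _ "{..n}"]) (use ideal_pos[OF J] in auto)
  have "{x. (j, x) \<in> J} \<noteq> {}" using diag_mem_iff[OF J, of j] j by auto
  then have "(j, row_end J j) \<in> J" using Max_in[OF fin] by (auto simp: row_end_def)
  moreover have "x \<le> row_end J j" if "(j, x) \<in> J" using Max_ge[OF fin] that by (auto simp: row_end_def)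
  ultimately show ?thesis using ideal_down[OF J, of j "row_end J j" j x] ideal_pos[OF J] j by auto
qed

lemma row_end_mem:
  assumes J: "J \<in> order_ideals n" and j: "1 \<le> j" "j \<le> height J"
  shows "(j, row_end J j) \<in> J"
  using mem_iff_row_end[OF assms] diag_mem_iff[OF J, of j] j by auto

lemma row_end_antimono:
  assumes J: "J \<in> order_ideals n" and j: "1 \<le> j" "j \<le> l" "l \<le> height J"
  shows "row_end J l \<le> row_end J j"
proof -
  have l: "(l, row_end J l) \<in> J" by (rule row_end_mem) (use J j in auto)
  then have "(j, row_end J l) \<in> J" using ideal_pos[OF J l] j by (intro ideal_down[OF J l]) auto
  then show ?thesis using mem_iff_row_end[OF J, of j] j by auto
qed

lemma mem_M_OC_iff:
  assumes J: "J \<in> order_ideals n" and j: "1 \<le> j" "j \<le> height J" "j < x"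
  shows "(j, x) \<in> M_OC n Os J \<longleftrightarrow>
    (j, x) \<in> J \<and> ((j, x) \<in> Os \<or> x = row_end J j \<and> (Suc j, x) \<notin> J)"
proof -
  have "(j, x) \<in> maximal_elems J \<longleftrightarrow> (j, x) \<in> J \<and> x = row_end J j \<and> (Suc j, x) \<notin> J"
  proof
    assume m: "(j, x) \<in> maximal_elems J"
    then have jx: "(j, x) \<in> J" and mx: "\<And>q. (j, x) \<preceq> q \<Longrightarrow> q \<in> J \<Longrightarrow> q = (j, x)"
      by (auto simp: maximal_elems_def)
    have "x \<le> row_end J j" using jx mem_iff_row_end[OF J j(1,2)] by simp
    then show "(j, x) \<in> J \<and> x = row_end J j \<and> (Suc j, x) \<notin> J"
      using jx mx[of "(j, row_end J j)"] mx[of "(Suc j, x)"] row_end_mem[OF J j(1,2)]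
      by (auto simp: ple_def)
  next
    assume a: "(j, x) \<in> J \<and> x = row_end J j \<and> (Suc j, x) \<notin> J"
    have "q = (j, x)" if q: "q \<in> J" "(j, x) \<preceq> q" for q
    proof -
      obtain a b where q': "q = (a, b)" "j \<le> a" "x \<le> b" using q by (cases q) (auto simp: ple_def)
      have ab: "(a, b) \<in> J" using q(1) q'(1) by simp
      have "(j, b) \<in> J" using q' j by (intro ideal_down[OF J ab]) auto
      then have "b = x" using a q' mem_iff_row_end[OF J j(1,2)] by auto
      moreover have "a = j"
      proof (rule ccontr)
        assume "a \<noteq> j"
        then have "(Suc j, x) \<in> J" using q' j \<open>b = x\<close> by (intro ideal_down[OF J ab]) auto
        then show False using a by blast
      qed
      ultimately show ?thesis using q' by simp
    qed
    then show "(j, x) \<in> maximal_elems J" using a unfolding maximal_elems_def by blast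
  qed
  then show ?thesis using j unfolding M_OC_def diag_def by blast
qed

text \<open>A row end that lies in \<open>C\<close> and is not maximal, i.e. below which the ideal continues, is missing
  from \<open>M(J)\<close>.\<close>

lemma last_entry_eq:
  assumes J: "J \<in> order_ideals n" and j: "1 \<le> j" "j \<le> height J"
  shows "last_entry J j = (if (j, row_end J j) \<in> Os \<or> (Suc j, row_end J j) \<notin> J
     then row_end J j else prev_entry Os j (row_end J j))"
proof -
  let ?r = "row_end J j"
  have r: "(j, ?r) \<in> J" "j \<le> ?r" "?r \<le> n"
    using row_end_mem[OF assms] ideal_pos[OF J, of j ?r] by auto
  note mem = mem_iff_row_end[OF assms] and M = mem_M_OC_iff[OF assms]
  show ?thesis
  proof (cases "(j, ?r) \<in> Os \<or> (Suc j, ?r) \<notin> J")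
    case True
    have "last_entry J j = prev_entry (M_OC n Os J) j (Suc ?r)"
      unfolding last_entry_def using r by (intro prev_entry_cong) (auto simp: M mem)
    also have "\<dots> = ?r"
    proof (cases "?r = j")
      case True
      then show ?thesis using prev_entry_cases[of "M_OC n Os J" j "Suc j"] by auto
    next
      case False
      then show ?thesis using r \<open>(j, ?r) \<in> Os \<or> (Suc j, ?r) \<notin> J\<close> by (auto simp: prev_entry_Suc M)
    qed
    finally show ?thesis using True by simp
  next
    case False
    have "last_entry J j = prev_entry Os j ?r"
      unfolding last_entry_def using r False by (intro prev_entry_cong) (auto simp: M mem le_less)
    then show ?thesis using False by simp
  qed
qed

lemma last_entry_bounds:
  assumes J: "J \<in> order_ideals n" and j: "1 \<le> j" "j \<le> height J"
  shows "j \<le> last_entry J j" "last_entry J j \<le> row_end J j" "last_entry J j \<in> {1..n}"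
proof -
  have r: "j \<le> row_end J j" "row_end J j \<le> n"
    using row_end_mem[OF assms] ideal_pos[OF J, of j "row_end J j"] by auto
  then show *: "j \<le> last_entry J j" "last_entry J j \<le> row_end J j"
    using prev_entry_ge[of j Os "row_end J j"] prev_entry_cases[of Os j "row_end J j"]
    by (auto simp: last_entry_eq[OF assms])
  show "last_entry J j \<in> {1..n}" using * r j by auto
qed

text \<open>In the rows above row \<open>j\<close> and in the columns up to the end of row \<open>j\<close> no element is maximal, so there
  \<open>M(J)\<close> agrees with \<open>Os\<close> off the diagonal.\<close>

lemma w_eq:
  assumes J: "J \<in> order_ideals n" and j: "1 \<le> j" "j \<le> height J"
  shows "w J j = U j (last_entry J j)"
proof -
  note b = last_entry_bounds[OF assms]
  have "w J j = upper_rows (M_OC n Os J) n j (last_entry J j)"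
    unfolding w_ideal_def last_entry_def using j height_le[OF J] by (intro w_perm_eval) auto
  also have "\<dots> = U j (last_entry J j)"
  proof (rule upper_rows_cong)
    fix i y assume i: "1 \<le> i" "i < j" "i < y" "y \<le> last_entry J j"
    then have y: "y \<le> row_end J j" using b by simp
    have "(i, y) \<in> J"
      using i y by (intro ideal_down[OF J row_end_mem[OF assms]]) auto
    moreover have "(Suc i, y) \<in> J"
      using i y by (intro ideal_down[OF J row_end_mem[OF assms]]) auto
    ultimately show "(i, y) \<in> M_OC n Os J \<longleftrightarrow> (i, y) \<in> Os"
      using i j by (subst mem_M_OC_iff[OF J]) auto
  qed (use b in auto)
  finally show ?thesis .
qed

lemma \<sigma>_w:
  assumes J: "J \<in> order_ideals n" and j: "1 \<le> j" "j \<le> height J"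
  shows "\<sigma> j (w J j) = last_entry J j"
  unfolding w_eq[OF assms] using j height_le[OF J] last_entry_bounds(3)[OF assms] by (intro \<sigma>_eqI) auto

lemma w_in: "x \<in> {1..n} \<Longrightarrow> w J x \<in> {1..n}"
  using permutes_in_image[OF upper_rows_permutes, of "M_OC n Os J" n "Suc n" x] by (simp add: w_ideal_def w_perm_upper_rows)

lemma tuple_simps: "length (tuple J) = height J" "j < height J \<Longrightarrow> tuple J ! j = w J (Suc j)"
  by (simp_all add: tuple_def del: upt_Suc)

text \<open>Write \<open>r\<close> for the end of row \<open>j\<close> and \<open>t = \<sigma>\<^bsub>j+1\<^esub>(w\<^sup>J(j))\<close>. If the last entry \<open>x\<close> of row \<open>j\<close> is in \<open>O\<close> or on the
  diagonal, then \<open>t\<close> is \<open>j\<close> or the next entry of \<open>O\<close> in that row, which lies beyond \<open>r\<close>. Otherwise \<open>t = x = r\<close>, and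
  \<open>(j, r)\<close> is maximal, so the lower rows end before \<open>r\<close>.\<close>

lemma OC_tuple_tuple:
  assumes J: "J \<in> order_ideals n" and k: "1 \<le> height J" "height J \<le> n - 1"
  shows "OC_tuple n Os (tuple J)"
proof -
  have nth: "tuple J ! (j - Suc 0) = w J j" if "1 \<le> j" "j \<le> height J" for j
    using that tuple_simps(2)[of "j - Suc 0" J] by simp
  have "inj (w J)" unfolding w_ideal_def w_perm_upper_rows by (rule permutes_inj[OF upper_rows_permutes])
  then have dist: "distinct (tuple J)" unfolding tuple_def by (simp add: distinct_map inj_on_subset)
  have set: "set (tuple J) \<subseteq> {1..n}" unfolding tuple_def using w_in k by force
  have sep: "\<sigma> (j + 1) (w J j) = j \<or> last_entry J l < \<sigma> (j + 1) (w J j)"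
    if jl: "1 \<le> j" "j < l" "l \<le> height J" for j l
  proof (cases "\<sigma> (j + 1) (w J j) = j")
    case False
    define t where "t = \<sigma> (Suc j) (w J j)"
    define r where "r = row_end J j"
    have tj: "t \<noteq> j" using False by (simp add: t_def)
    have j: "1 \<le> j" "j \<le> height J" and l: "1 \<le> l" "l \<le> height J" using jl by auto
    have wj: "w J j \<in> {1..n}" using w_in j k by auto
    have s: "last_entry J j = (if j < t \<and> (j, t) \<in> Os then prev_entry Os j t else t)"
      using \<sigma>_step[of j "w J j"] jl k wj tj \<sigma>_w[OF J j] by (simp add: t_def)
    have e: "last_entry J j = (if (j, r) \<in> Os \<or> (Suc j, r) \<notin> J then r else prev_entry Os j r)"
      unfolding r_def by (rule last_entry_eq[OF J j])
    have ll: "last_entry J l \<le> row_end J l" by (rule last_entry_bounds[OF J l])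
    have lr: "row_end J l \<le> r" unfolding r_def by (rule row_end_antimono) (use J jl in auto)
    have "last_entry J l < t"
    proof (cases "j < t \<and> (j, t) \<in> Os")
      case True
      then have st: "last_entry J j = prev_entry Os j t" "prev_entry Os j t < t" using s prev_entry_less by auto
      have "r < t"
      proof (cases "(j, r) \<in> Os \<or> (Suc j, r) \<notin> J")
        case False
        then have "prev_entry Os j r < t" using e st by simp
        then have "\<not> t < r" using prev_entry_upper[of j t r Os] True by auto
        moreover have "t \<noteq> r" using True False by auto
        ultimately show ?thesis by simp
      qed (use e st in simp)
      then show ?thesis using ll lr by simp
    next
      case False
      then have st: "last_entry J j = t" using s by auto
      then have t: "j < t" "(j, t) \<notin> Os" using False tj last_entry_bounds(1)[OF J j] by auto
      have nJ: "(j, r) \<in> Os \<or> (Suc j, r) \<notin> J"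
      proof (rule ccontr)
        assume "\<not> ?thesis"
        then have "t = prev_entry Os j r" using e st by simp
        then show False using prev_entry_cases[of Os j r] t by auto
      qed
      then have tr: "t = r" using e st by simp
      then have "(Suc j, r) \<notin> J" using nJ t by auto
      moreover have "(Suc j, row_end J l) \<in> J"
        using ideal_pos[OF J row_end_mem[OF J l]] jl by (intro ideal_down[OF J row_end_mem[OF J l]]) auto
      ultimately have "row_end J l < r" using lr by (metis le_neq_implies_less)
      then show ?thesis using ll tr by simp
    qed
    then show ?thesis by (simp add: t_def)
  qed simp
  show ?thesis
    unfolding OC_tuple_def Let_def tuple_simps(1)
    using k dist set sep last_entry_bounds(1)[OF J] by (auto simp: nth \<sigma>_w[OF J])
qed

text \<open>In the last row with the same end as row \<open>j\<close>, the row end is maximal and therefore an entry of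
  \<open>M(J)\<close>. Together with \<open>last_entry_bounds\<close> this expresses the row ends of \<open>J\<close> by its tuple.\<close>

lemma row_end_attained:
  assumes J: "J \<in> order_ideals n" and j: "1 \<le> j" "j \<le> height J"
  shows "\<exists>l. j \<le> l \<and> l \<le> height J \<and> last_entry J l = row_end J j"
proof -
  \<comment> \<open>The last row with the same end as row \<open>j\<close> is the maximum of \<open>L\<close>.\<close>
  define L where "L = {l. j \<le> l \<and> l \<le> height J \<and> row_end J l = row_end J j}"
  have fin: "finite L" by (rule finite_subset[of _ "{..height J}"]) (auto simp: L_def)
  have "j \<in> L" using j by (simp add: L_def)
  define l where "l = Max L"
  have l: "l \<in> L" unfolding l_def using fin \<open>j \<in> L\<close> by (intro Max_in) auto
  then have l': "1 \<le> l" "l \<le> height J" "j \<le> l" "row_end J l = row_end J j" using j by (auto simp: L_def)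
  have "(Suc l, row_end J l) \<notin> J"
  proof
    assume a: "(Suc l, row_end J l) \<in> J"
    then have h: "Suc l \<le> height J" using mem_height[OF J] by blast
    then have "row_end J l \<le> row_end J (Suc l)" using a mem_iff_row_end[OF J, of "Suc l"] by auto
    moreover have "row_end J (Suc l) \<le> row_end J l" by (rule row_end_antimono) (use J h l' in auto)
    ultimately have "Suc l \<in> L" using l' h by (auto simp: L_def)
    then show False using Max_ge[OF fin] unfolding l_def by fastforce
  qed
  then have "last_entry J l = row_end J j" using last_entry_eq[OF J l'(1,2)] l' by simp
  then show ?thesis using l' by auto
qed

text \<open>The ideal is forced by \<open>row_end_attained\<close>: row \<open>j\<close> ends at the maximum \<open>m j\<close> of the \<open>s l\<close> with
  \<open>l \<ge> j\<close>. It remains to see that \<open>s j\<close> is the last entry of that ideal in row \<open>j\<close>. This is where the separation condition on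
  \<open>(O,C)\<close>-tuples enters: if a lower row reaches \<open>m j\<close> as well, then no element of \<open>O\<close> in row \<open>j\<close> lies strictly
  between \<open>s j\<close> and \<open>m j\<close>, nor does \<open>m j\<close> itself unless it equals \<open>s j\<close>.\<close>

lemma OC_tuple_is_tuple:
  assumes oc: "OC_tuple n Os is"
  shows "\<exists>J \<in> order_ideals n. height J = length is \<and> tuple J = is"
proof -
  define k where "k = length is"
  define e where "e j = is ! (j - 1)" for j
  define s where "s j = \<sigma> j (e j)" for j
  define m where "m j = Max (s ` {j..k})" for j
  define J where "J = {(j, x). 1 \<le> j \<and> j \<le> k \<and> j \<le> x \<and> x \<le> m j}"
  have k: "1 \<le> k" "k \<le> n - 1"
    and setis: "set is \<subseteq> {1..n}"
    and sj: "\<And>j. 1 \<le> j \<Longrightarrow> j \<le> k \<Longrightarrow> j \<le> s j"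
    and sep: "\<And>j l. 1 \<le> j \<Longrightarrow> j < l \<Longrightarrow> l \<le> k \<Longrightarrow> \<sigma> (Suc j) (e j) = j \<or> s l < \<sigma> (Suc j) (e j)"
    using oc unfolding OC_tuple_def Let_def k_def[symmetric] e_def[symmetric] s_def[symmetric]
    by auto
  have e: "e j \<in> {1..n}" if "1 \<le> j" "j \<le> k" for j
  proof -
    have "e j \<in> set is" unfolding e_def using that by (intro nth_mem) (simp add: k_def)
    then show ?thesis using setis by blast
  qed
  have sn: "s j \<le> n" if "1 \<le> j" "j \<le> k" for j
    using \<sigma>_in[of j "e j"] e[OF that] that k by (auto simp: s_def)
  have m_ge: "s l \<le> m j" if "j \<le> l" "l \<le> k" for j l
    unfolding m_def using that by (intro Max_ge) auto
  have m_att: "\<exists>l. j \<le> l \<and> l \<le> k \<and> m j = s l" if "j \<le> k" for j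
  proof -
    have "m j \<in> s ` {j..k}" unfolding m_def by (rule Max_in) (use that in auto)
    then show ?thesis by auto
  qed
  have m_k: "k \<le> m j" if "j \<le> k" for j
    using m_ge[OF that, of] sj[of k] k by simp
  have m_anti: "m l \<le> m j" if "j \<le> l" "l \<le> k" for j l
    using m_att[OF that(2)] m_ge[of j] that by auto
  have m_n: "m j \<le> n" if "1 \<le> j" "j \<le> k" for j
    using m_att[OF that(2)] sn that by (metis order.trans)
  have J: "J \<in> order_ideals n"
    unfolding order_ideals_def J_def pos_def ple_def
    using m_n m_anti by (auto intro: order.trans)
  have "J \<inter> diag n = (\<lambda>i. (i, i)) ` {1..k}"
    using m_k k by (auto simp: J_def diag_def intro: order.trans)
  then have h: "height J = k" by (simp add: card_image inj_on_def)
  have re: "row_end J j = m j" if "1 \<le> j" "j \<le> k" for j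
    unfolding row_end_def J_def using that m_k[of j] by (intro Max_eqI) (auto intro: finite_subset[of _ "{..m j}"])
  have le: "last_entry J j = s j" if j: "1 \<le> j" "j \<le> k" for j
  proof -
    define r where "r = m j"
    define t where "t = \<sigma> (Suc j) (e j)"
    have sr: "s j \<le> r" unfolding r_def by (rule m_ge) (use j in auto)
    have jr: "j \<le> r" using m_k[OF j(2)] j by (simp add: r_def)
    have rn: "r \<le> n" unfolding r_def by (rule m_n[OF j])
    have st: "s j = (if t = j then prev_entry Os j (Suc n) else if j < t \<and> (j, t) \<in> Os then prev_entry Os j t else t)"
      unfolding s_def t_def by (rule \<sigma>_step) (use j k e in auto)
    have eq: "last_entry J j = (if (j, r) \<in> Os \<or> (Suc j, r) \<notin> J then r else prev_entry Os j r)"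
      using last_entry_eq[OF J, of j] re[OF j] j h by (simp add: r_def)
    show ?thesis
    proof (cases "(Suc j, r) \<in> J")
      case False
      obtain l where l: "j \<le> l" "l \<le> k" "r = s l" using m_att[OF j(2)] by (auto simp: r_def)
      have "l = j"
      proof (rule ccontr)
        assume "l \<noteq> j"
        then have "Suc j \<le> l" using l by simp
        then have "r \<le> m (Suc j)" "Suc j \<le> r" using m_ge[of "Suc j" l] l sj[of l] j by auto
        then show False using False \<open>Suc j \<le> l\<close> l by (auto simp: J_def)
      qed
      then show ?thesis using eq False l by simp
    next
      case True
      then have T: "Suc j \<le> k" "Suc j \<le> r" "r \<le> m (Suc j)" by (auto simp: J_def)
      obtain l where l: "Suc j \<le> l" "l \<le> k" "m (Suc j) = s l" using m_att[OF T(1)] by auto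
      have t: "t = j \<or> r < t" using sep[of j l] j l T by (auto simp: t_def)
      show ?thesis
      proof (cases "(j, r) \<in> Os")
        case True
        have "r \<le> s j"
        proof (cases "t = j")
          case True
          then show ?thesis using st prev_entry_upper[of j r "Suc n" Os] \<open>(j, r) \<in> Os\<close> T rn by auto
        next
          case False
          then show ?thesis using st t prev_entry_upper[of j r t Os] \<open>(j, r) \<in> Os\<close> T by auto
        qed
        then show ?thesis using eq True sr by simp
      next
        case False
        have "s j = prev_entry Os j r"
        proof (cases "t = j")
          case True
          then have "s j = prev_entry Os j (Suc n)" using st by simp
          moreover have "prev_entry Os j (Suc n) = prev_entry Os j r"
          proof (rule prev_entry_cong)
            fix y assume "j < y"
            show "y < Suc n \<and> (j, y) \<in> Os \<longleftrightarrow> y < r \<and> (j, y) \<in> Os"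
              using prev_entry_upper[of j y "Suc n" Os] \<open>j < y\<close> sr calculation False rn by (auto simp: le_less)
          qed
          ultimately show ?thesis by simp
        next
          case F: False
          then have "r < t" using t by simp
          then have o: "(j, t) \<in> Os" "s j = prev_entry Os j t" using st F sr T by (auto split: if_splits)
          moreover have "prev_entry Os j t = prev_entry Os j r"
          proof (rule prev_entry_cong)
            fix y assume "j < y"
            show "y < t \<and> (j, y) \<in> Os \<longleftrightarrow> y < r \<and> (j, y) \<in> Os"
              using prev_entry_upper[of j y t Os] \<open>j < y\<close> sr o(2) False \<open>r < t\<close> by (auto simp: le_less)
          qed
          ultimately show ?thesis by simp
        qed
        then show ?thesis using eq False True by simp
      qed
    qed
  qed
  have "tuple J = is"
  proof (rule nth_equalityI)
    fix i assume "i < length (tuple J)"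
    then have i: "i < k" using h by (simp add: tuple_simps)
    have "w J (Suc i) = U (Suc i) (s (Suc i))" using w_eq[OF J, of "Suc i"] le[of "Suc i"] i h by simp
    also have "\<dots> = e (Suc i)" unfolding s_def by (rule U_\<sigma>) (use i k e[of "Suc i"] in auto)
    finally show "tuple J ! i = is ! i" using i h by (simp add: tuple_simps e_def)
  qed (simp add: tuple_simps h k_def)
  then show ?thesis using J h k_def by blast
qed

lemma ideal_subset_iff:
  assumes J: "J \<in> order_ideals n" and J': "J' \<in> order_ideals n" and h: "height J \<le> height J'"
  shows "J \<subseteq> J' \<longleftrightarrow> (\<forall>j\<in>{1..height J}. \<exists>j'\<in>{j..height J'}. last_entry J j \<le> last_entry J' j')"
proof
  assume sub: "J \<subseteq> J'"
  show "\<forall>j\<in>{1..height J}. \<exists>j'\<in>{j..height J'}. last_entry J j \<le> last_entry J' j'"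
  proof
    fix j assume "j \<in> {1..height J}"
    then have j: "1 \<le> j" "j \<le> height J" "j \<le> height J'" using h by auto
    have "(j, row_end J j) \<in> J'" using row_end_mem[OF J j(1,2)] sub by blast
    then have "row_end J j \<le> row_end J' j" using mem_iff_row_end[OF J' j(1,3)] by simp
    moreover obtain l where "j \<le> l" "l \<le> height J'" "last_entry J' l = row_end J' j"
      using row_end_attained[OF J' j(1,3)] by blast
    moreover have "last_entry J j \<le> row_end J j" by (rule last_entry_bounds[OF J j(1,2)])
    ultimately show "\<exists>j'\<in>{j..height J'}. last_entry J j \<le> last_entry J' j'" by (intro bexI[of _ l]) auto
  qed
next
  assume R: "\<forall>j\<in>{1..height J}. \<exists>j'\<in>{j..height J'}. last_entry J j \<le> last_entry J' j'"
  show "J \<subseteq> J'"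
  proof (rule subrelI)
    fix j x assume jx: "(j, x) \<in> J"
    then have j: "1 \<le> j" "j \<le> height J" using mem_height[OF J] by auto
    then have x: "j \<le> x" "x \<le> row_end J j" using mem_iff_row_end[OF J j] jx by auto
    obtain l where l: "j \<le> l" "l \<le> height J" "last_entry J l = row_end J j" using row_end_attained[OF J j] by blast
    then obtain l' where l': "l \<le> l'" "l' \<le> height J'" "last_entry J l \<le> last_entry J' l'" using R j by force
    have "last_entry J' l' \<le> row_end J' l'" by (rule last_entry_bounds[OF J']) (use j l l' in auto)
    also have "\<dots> \<le> row_end J' j" by (rule row_end_antimono[OF J']) (use j l l' in auto)
    finally have "x \<le> row_end J' j" using x l l' by simp
    then show "(j, x) \<in> J'" using mem_iff_row_end[OF J', of j x] x j h by simp
  qed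
qed
end

section \<open>Leading terms and the recovery of chains\<close>

lemma prod_Var: "(\<Prod>c\<in>A. Var (f c)) = Poly_Mapping.single (\<Sum>c\<in>A. Poly_Mapping.single (f c) 1) 1"
proof (cases "finite A")
  case True
  then show ?thesis by (induction A) (simp_all add: Var_def mult_single)
qed simp

lemma weighted_sum_bound:
  fixes g :: "nat \<Rightarrow> nat"
  assumes "s \<le> k" "k \<le> n" "\<And>r. r < k \<Longrightarrow> g r < B" "0 < B"
  shows "(\<Sum>r = s..<k. B ^ (n - Suc r) * g r) < B ^ (n - s)"
  using assms(1)
proof (induction s rule: inc_induct)
  case base
  show ?case using assms(4) by simp
next
  case (step s)
  have "(\<Sum>r = s..<k. B ^ (n - Suc r) * g r) = B ^ (n - Suc s) * g s + (\<Sum>r = Suc s..<k. B ^ (n - Suc r) * g r)"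
    using step by (simp add: sum.atLeast_Suc_lessThan)
  also have "\<dots> < B ^ (n - Suc s) * g s + B ^ (n - Suc s)" using step by simp
  also have "\<dots> = B ^ (n - Suc s) * Suc (g s)" by simp
  also have "\<dots> \<le> B ^ (n - Suc s) * B" using assms(3)[of s] step by (intro mult_left_mono) auto
  also have "\<dots> = B ^ (n - s)"
    using step assms(2) by (metis Suc_diff_Suc less_le_trans mult.commute power_Suc)
  finally show ?case .
qed

text \<open>Powers of \<open>B\<close> turn lexicographic comparison of digit sequences below \<open>B\<close> into comparison of numbers.\<close>

lemma weighted_sum_lex_less:
  fixes f g :: "nat \<Rightarrow> nat"
  assumes "k \<le> n" "\<And>r. r < k \<Longrightarrow> g r < B" "m < k" "g m < f m" "\<And>r. r < m \<Longrightarrow> g r = f r"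
  shows "(\<Sum>r = 0..<k. B ^ (n - Suc r) * g r) < (\<Sum>r = 0..<k. B ^ (n - Suc r) * f r)"
proof -
  have split: "(\<Sum>r = 0..<k. h r) = (\<Sum>r = 0..<m. h r) + (h m + (\<Sum>r = Suc m..<k. h r))" for h :: "nat \<Rightarrow> nat"
  proof -
    have "(\<Sum>r = 0..<k. h r) = (\<Sum>r = 0..<m. h r) + (\<Sum>r = m..<k. h r)"
      using assms(3) by (simp add: sum.atLeastLessThan_concat)
    then show ?thesis using assms(3) by (simp add: sum.atLeast_Suc_lessThan)
  qed
  have "0 < B" using assms(2)[OF assms(3)] by linarith
  then have "(\<Sum>r = Suc m..<k. B ^ (n - Suc r) * g r) < B ^ (n - Suc m)"
    by (intro weighted_sum_bound) (use assms(1-3) in auto)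
  then have "B ^ (n - Suc m) * g m + (\<Sum>r = Suc m..<k. B ^ (n - Suc r) * g r) < B ^ (n - Suc m) * Suc (g m)"
    by simp
  also have "\<dots> \<le> B ^ (n - Suc m) * f m" using assms(4) by (intro mult_left_mono) auto
  finally have "B ^ (n - Suc m) * g m + (\<Sum>r = Suc m..<k. B ^ (n - Suc r) * g r)
     < B ^ (n - Suc m) * f m + (\<Sum>r = Suc m..<k. B ^ (n - Suc r) * f r)" by simp
  moreover have "(\<Sum>r = 0..<m. B ^ (n - Suc r) * g r) = (\<Sum>r = 0..<m. B ^ (n - Suc r) * f r)"
    using assms(5) by simp
  ultimately show ?thesis unfolding split by simp
qed

text \<open>The members of an increasing chain that contain \<open>p\<close> form a final segment of the chain.\<close>

lemma chain_nth_mem_iff: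
  assumes "sorted_wrt (\<subseteq>) Js" "i < length Js"
  shows "p \<in> Js ! i \<longleftrightarrow> length Js - i \<le> length (filter (\<lambda>J. p \<in> J) Js)"
  using assms
proof (induction Js arbitrary: i)
  case (Cons J Js)
  show ?case
  proof (cases "p \<in> J")
    case True
    then have "\<forall>K\<in>set (J # Js). p \<in> K" using Cons.prems(1) by auto
    then have "filter (\<lambda>J. p \<in> J) (J # Js) = J # Js" "p \<in> (J # Js) ! i"
      using nth_mem[OF Cons.prems(2)] by (auto intro!: filter_True)
    then show ?thesis using Cons.prems(2) by simp
  next
    case False
    show ?thesis
    proof (cases i)
      case 0
      have "length (filter (\<lambda>J. p \<in> J) Js) \<le> length Js" by (rule length_filter_le)
      then have "\<not> Suc (length Js) \<le> length (filter (\<lambda>J. p \<in> J) Js)" by linarith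
      then show ?thesis using 0 False by simp
    next
      case (Suc k)
      then show ?thesis using Cons.IH[of k] Cons.prems False by simp
    qed
  qed
qed simp

lemma chain_count_disj:
  assumes "sorted_wrt (\<subseteq>) Js"
  shows "length (filter (\<lambda>J. p \<in> J \<or> q \<in> J) Js)
    = max (length (filter (\<lambda>J. p \<in> J) Js)) (length (filter (\<lambda>J. q \<in> J) Js))"
  using assms
proof (induction Js)
  case (Cons J Js)
  have all: "x \<in> J \<Longrightarrow> filter (\<lambda>J. x \<in> J) Js = Js" for x
    using Cons.prems by (auto intro!: filter_True)
  have all2: "p \<in> J \<or> q \<in> J \<Longrightarrow> filter (\<lambda>J. p \<in> J \<or> q \<in> J) Js = Js"
    using Cons.prems by (auto intro!: filter_True)
  show ?case using Cons all[of p] all[of q] all2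
    length_filter_le[of "\<lambda>J. p \<in> J" Js] length_filter_le[of "\<lambda>J. q \<in> J" Js]
    by (auto simp: max_def intro: le_SucI)
qed simp

text \<open>The exponent of the diagonal term of the minor with columns \<open>xs\<close>.\<close>

definition lead_exponent :: "nat list \<Rightarrow> (nat \<times> nat) \<Rightarrow>\<^sub>0 nat" where
  "lead_exponent xs = (\<Sum>j = 0..<length xs. Poly_Mapping.single (j + 1, xs ! j) 1)"

context oc_partition
begin

text \<open>In row \<open>j\<close> of the matrix, columns are preferred in decreasing order of their position \<open>\<sigma>\<^bsub>j+1\<^esub>\<close>, except that a
  column which has just jumped to the diagonal is preferred to all others. By the definition
  of \<open>(O,C)\<close>-tuples, picking greedily row by row reproduces the tuple.\<close>

definition priority :: "nat \<Rightarrow> nat \<Rightarrow> nat" where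
  "priority j x = (if \<sigma> (Suc j) x = j then n + 1 else \<sigma> (Suc j) x)"

text \<open>The weights make higher rows of the matrix dominate all lower ones; \<open>n + 2\<close> exceeds every priority.\<close>

definition weight :: "nat \<times> nat \<Rightarrow> nat" where
  "weight v = (n + 2) ^ (n - fst v) * priority (fst v) (snd v)"

lemma priority_decreasing:
  assumes oc: "OC_tuple n Os xs" and jl: "j < l" "l < length xs"
  shows "priority (Suc j) (xs ! l) < priority (Suc j) (xs ! j)"
proof -
  have k: "length xs \<le> n - 1" and xs: "set xs \<subseteq> {1..n}"
    and ge: "\<And>j. 1 \<le> j \<Longrightarrow> j \<le> length xs \<Longrightarrow> j \<le> \<sigma> j (xs ! (j - 1))"
    and sep: "\<And>j l. 1 \<le> j \<Longrightarrow> j < l \<Longrightarrow> l \<le> length xs \<Longrightarrow>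
       \<sigma> (j + 1) (xs ! (j - 1)) = j \<or> \<sigma> l (xs ! (l - 1)) < \<sigma> (j + 1) (xs ! (j - 1))"
    using oc by (auto simp: OC_tuple_def Let_def)
  have x: "xs ! l \<in> {1..n}" using xs jl nth_mem by blast
  have l: "Suc l \<le> \<sigma> (Suc l) (xs ! l)" using ge[of "Suc l"] jl by simp
  have m: "Suc (Suc j) \<le> \<sigma> (Suc (Suc j)) (xs ! l)"
    "\<sigma> (Suc (Suc j)) (xs ! l) \<le> \<sigma> (Suc l) (xs ! l)"
    using \<sigma>_mono[of "Suc (Suc j)" "Suc l" "xs ! l"] jl k x l by auto
  have "\<sigma> (Suc (Suc j)) (xs ! l) \<le> n" using \<sigma>_in[of "Suc (Suc j)" "xs ! l"] x jl k by auto
  then show ?thesis using m sep[of "Suc j" "Suc l"] jl by (auto simp: priority_def)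
qed

lemma priority_bound:
  assumes "1 \<le> j" "j < n" "x \<in> {1..n}"
  shows "priority j x < n + 2"
  using \<sigma>_in[of "Suc j" x] assms by (auto simp: priority_def)

text \<open>A permutation of the columns other than the identity first deviates from it in some row \<open>m\<close>, and
  there it uses a column further to the right in \<open>xs\<close>, which has smaller priority.\<close>

lemma minor_leads:
  assumes oc: "OC_tuple n Os xs"
  shows "leads weight (minor xs) (lead_exponent xs)"
proof -
  let ?k = "length xs"
  have k: "?k \<le> n - 1" "1 \<le> ?k" and xs: "set xs \<subseteq> {1..n}" using oc by (auto simp: OC_tuple_def Let_def)
  define mon :: "(nat \<Rightarrow> nat) \<Rightarrow> nat \<times> nat \<Rightarrow>\<^sub>0 nat"
    where "mon \<tau> = (\<Sum>c = 0..<?k. Poly_Mapping.single (\<tau> c + 1, xs ! c) 1)" for \<tau>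
  let ?P = "{\<tau>. \<tau> permutes {0..<?k}}"
  let ?q = "\<Sum>\<tau>\<in>?P - {id}. Poly_Mapping.single (mon \<tau>) (of_int (sign \<tau>) :: complex)"
  have fin: "finite ?P" by (simp add: finite_permutations)
  have "minor xs = (\<Sum>\<tau>\<in>?P. Poly_Mapping.single (mon \<tau>) (of_int (sign \<tau>)))"
    unfolding minor_expand prod_Var mon_def
    by (intro sum.cong refl) (simp only: of_int_eq_Const Const_def mult_single add_0_left mult_1_right)
  also have "\<dots> = Poly_Mapping.single (mon id) (of_int (sign (id :: nat \<Rightarrow> nat))) + ?q"
    by (rule sum.remove[OF fin]) (simp add: permutes_id)
  finally have eq: "minor xs = Poly_Mapping.single (lead_exponent xs) 1 + ?q"
    by (simp add: mon_def lead_exponent_def)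
  have less: "wt weight (mon \<tau>) < wt weight (lead_exponent xs)" if \<tau>: "\<tau> permutes {0..<?k}" "\<tau> \<noteq> id" for \<tau>
  proof -
    \<comment> \<open>\<open>\<tau>\<close> sends columns to rows; weights are compared row by row, so its inverse is used.\<close>
    define \<pi> where "\<pi> = Hilbert_Choice.inv \<tau>"
    have \<pi>: "\<pi> permutes {0..<?k}" unfolding \<pi>_def by (rule permutes_inv[OF \<tau>(1)])
    have "\<pi> \<noteq> id" using \<tau> unfolding \<pi>_def by (metis inv_id permutes_inv_inv)
    then have ex: "\<exists>r. \<pi> r \<noteq> r" by auto
    define m where "m = (LEAST r. \<pi> r \<noteq> r)"
    have m: "\<pi> m \<noteq> m" unfolding m_def using ex by (rule LeastI_ex)
    have below: "\<pi> r = r" if "r < m" for r using not_less_Least[of r "\<lambda>r. \<pi> r \<noteq> r"] that by (auto simp: m_def)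
    have mk: "m < ?k" using permutes_not_in[OF \<pi>, of m] m by auto
    have \<pi>mk: "\<pi> m < ?k" using permutes_nat_less[OF \<pi> mk] .
    have "m < \<pi> m"
    proof (rule ccontr)
      assume "\<not> m < \<pi> m"
      then have "\<pi> (\<pi> m) = \<pi> m" using m by (intro below) auto
      then show False using m permutes_inj[OF \<pi>] by (auto simp: inj_def)
    qed
    have "wt weight (mon \<tau>) = (\<Sum>c = 0..<?k. weight (\<tau> c + 1, xs ! c))"
      by (simp add: mon_def wt_sum wt_single)
    also have "\<dots> = (\<Sum>c = 0..<?k. weight (\<tau> c + 1, xs ! \<pi> (\<tau> c)))"
      unfolding \<pi>_def using permutes_inverses[OF \<tau>(1)] by simp
    also have "\<dots> = (\<Sum>r = 0..<?k. weight (r + 1, xs ! \<pi> r))"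
      using sum.permute[OF \<tau>(1), of "\<lambda>r. weight (r + 1, xs ! \<pi> r)"] by (simp add: o_def)
    also have "\<dots> = (\<Sum>r = 0..<?k. (n + 2) ^ (n - Suc r) * priority (Suc r) (xs ! \<pi> r))"
      by (simp add: weight_def)
    also have "\<dots> < (\<Sum>r = 0..<?k. (n + 2) ^ (n - Suc r) * priority (Suc r) (xs ! r))"
    proof (rule weighted_sum_lex_less[where m = m])
      fix r assume r: "r < ?k"
      have "xs ! \<pi> r \<in> {1..n}" using permutes_nat_less[OF \<pi> r] xs nth_mem by blast
      then show "priority (Suc r) (xs ! \<pi> r) < n + 2" using r k by (intro priority_bound) auto
    next
      show "priority (Suc m) (xs ! \<pi> m) < priority (Suc m) (xs ! m)"
        by (rule priority_decreasing[OF oc \<open>m < \<pi> m\<close> \<pi>mk])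
    qed (use k mk below in auto)
    also have "\<dots> = wt weight (lead_exponent xs)"
      by (simp add: lead_exponent_def wt_sum wt_single weight_def)
    finally show ?thesis .
  qed
  show ?thesis
  proof (rule leadsI[OF eq])
    fix m assume "m \<in> Poly_Mapping.keys ?q"
    then obtain \<tau> where "\<tau> \<in> ?P - {id}" "m \<in> Poly_Mapping.keys (Poly_Mapping.single (mon \<tau>) (of_int (sign \<tau>) :: complex))"
      using keys_sum[of "\<lambda>\<tau>. Poly_Mapping.single (mon \<tau>) (of_int (sign \<tau>) :: complex)" "?P - {id}"] by blast
    then show "wt weight m < wt weight (lead_exponent xs)" using less by (auto split: if_splits)
  qed
qed

lemma lookup_lead_exponent:
  assumes J: "J \<in> order_ideals n" and j: "1 \<le> j" "j \<le> n" and c: "c \<in> {1..n}"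
  shows "Poly_Mapping.lookup (lead_exponent (tuple J)) (j, U j c) = of_bool (j \<le> height J \<and> last_entry J j = c)"
proof -
  have "Poly_Mapping.lookup (lead_exponent (tuple J)) (j, U j c)
      = (\<Sum>i = 0..<height J. of_bool (i = j - 1 \<and> w J j = U j c))"
    unfolding lead_exponent_def tuple_simps lookup_sum using j
    by (intro sum.cong refl) (auto simp: lookup_single when_def tuple_simps)
  also have "\<dots> = (\<Sum>i = 0..<height J. if i = j - 1 then of_bool (w J j = U j c) else 0)"
    by (intro sum.cong) auto
  also have "\<dots> = of_bool (j \<le> height J \<and> w J j = U j c)"
    using j by (auto simp: sum.delta)
  also have "\<dots> = of_bool (j \<le> height J \<and> last_entry J j = c)"
  proof (cases "j \<le> height J")
    case True
    show ?thesis unfolding w_eq[OF J j(1) True] inj_eq[OF inj_U] by simp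
  qed simp
  finally show ?thesis .
qed

text \<open>These numbers are exponents of variables in the leading term of a chain
  (\<open>lookup_chain_lead_exponent\<close>); the numbers \<open>mem_count\<close> below are to be recovered from them.\<close>

definition entry_count :: "(nat \<times> nat) set list \<Rightarrow> nat \<Rightarrow> nat \<Rightarrow> nat" where
  "entry_count Js j c = length (filter (\<lambda>J. j \<le> height J \<and> last_entry J j = c) Js)"

definition mem_count :: "(nat \<times> nat) set list \<Rightarrow> nat \<Rightarrow> nat \<Rightarrow> nat" where
  "mem_count Js j c = length (filter (\<lambda>J. (j, c) \<in> J) Js)"

lemma lookup_chain_lead_exponent:
  assumes "set Js \<subseteq> order_ideals n" "1 \<le> j" "j \<le> n" "c \<in> {1..n}"
  shows "Poly_Mapping.lookup (\<Sum>J\<leftarrow>Js. lead_exponent (tuple J)) (j, U j c) = entry_count Js j c"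
  using assms(1)
  by (induction Js) (use assms(2-) in \<open>auto simp: entry_count_def lookup_add lookup_lead_exponent\<close>)

lemma mem_iff_last_entry:
  assumes J: "J \<in> order_ideals n" and c: "1 \<le> j" "j \<le> c" and O: "(j, c) \<in> Os \<or> c = j"
  shows "(j, c) \<in> J \<longleftrightarrow> j \<le> height J \<and> c \<le> last_entry J j"
proof (cases "j \<le> height J")
  case True
  note b = last_entry_bounds[OF J c(1) True] and e = last_entry_eq[OF J c(1) True]
    and m = mem_iff_row_end[OF J c(1) True]
  show ?thesis
  proof
    assume "(j, c) \<in> J"
    then have le: "c \<le> row_end J j" using m by simp
    show "j \<le> height J \<and> c \<le> last_entry J j"
    proof (cases "(j, row_end J j) \<in> Os \<or> (Suc j, row_end J j) \<notin> J")
      case False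
      then have "last_entry J j = prev_entry Os j (row_end J j)" using e by simp
      moreover have "c \<le> prev_entry Os j (row_end J j)"
      proof (cases "c = j")
        case False
        then have "(j, c) \<in> Os" "j < c" using O c by auto
        moreover have "c \<noteq> row_end J j" using \<open>\<not> (_ \<or> _)\<close> \<open>(j, c) \<in> Os\<close> by auto
        ultimately show ?thesis using le by (intro prev_entry_upper) auto
      qed (simp add: prev_entry_ge)
      ultimately show ?thesis using True by simp
    qed (use e le True in simp)
  qed (use b m c in auto)
qed (use mem_height[OF J] in blast)

text \<open>For \<open>(j, c)\<close> in \<open>C\<close>, being the last entry means being maximal in \<open>J\<close>: an element of \<open>J\<close> is either maximal or
  has one of its two upper neighbours in \<open>J\<close>.\<close>

lemma mem_C_iff:
  assumes J: "J \<in> order_ideals n" and c: "1 \<le> j" "j < c" and C: "(j, c) \<notin> Os"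
  shows "(j, c) \<in> J \<longleftrightarrow> (j \<le> height J \<and> last_entry J j = c) \<or> ((j, Suc c) \<in> J \<or> (Suc j, c) \<in> J)"
    and "j \<le> height J \<Longrightarrow> last_entry J j = c \<Longrightarrow> (j, Suc c) \<notin> J \<and> (Suc j, c) \<notin> J"
proof -
  have down: "(j, c) \<in> J" if "(j, Suc c) \<in> J \<or> (Suc j, c) \<in> J"
    using that ideal_down[OF J, of j "Suc c" j c] ideal_down[OF J, of "Suc j" c j c] c by auto
  have L: "last_entry J j = c \<longleftrightarrow> row_end J j = c \<and> (Suc j, c) \<notin> J" if h: "j \<le> height J"
    using last_entry_eq[OF J c(1) h] prev_entry_cases[of Os j "row_end J j"] c C by (auto split: if_splits)
  have m: "(j, x) \<in> J \<longleftrightarrow> j \<le> x \<and> x \<le> row_end J j" if "j \<le> height J" for x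
    by (rule mem_iff_row_end[OF J c(1) that])
  show "(j, c) \<in> J \<longleftrightarrow> (j \<le> height J \<and> last_entry J j = c) \<or> ((j, Suc c) \<in> J \<or> (Suc j, c) \<in> J)"
  proof
    assume jc: "(j, c) \<in> J"
    then have h: "j \<le> height J" using mem_height[OF J] by blast
    then show "(j \<le> height J \<and> last_entry J j = c) \<or> ((j, Suc c) \<in> J \<or> (Suc j, c) \<in> J)"
      using jc m[OF h, of c] m[OF h, of "Suc c"] L[OF h] by auto
  next
    assume "(j \<le> height J \<and> last_entry J j = c) \<or> ((j, Suc c) \<in> J \<or> (Suc j, c) \<in> J)"
    then show "(j, c) \<in> J" using down L m[of c] c by auto
  qed
  show "(j, Suc c) \<notin> J \<and> (Suc j, c) \<notin> J" if h: "j \<le> height J" and "last_entry J j = c"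
    using that L[OF h] m[OF h, of "Suc c"] by auto
qed

lemma mem_count_O:
  assumes "set Js \<subseteq> order_ideals n" "1 \<le> j" "j \<le> c" "(j, c) \<in> Os \<or> c = j"
  shows "mem_count Js j c = (\<Sum>x = c..n. entry_count Js j x)"
  using assms(1)
proof (induction Js)
  case (Cons J Js)
  have J: "J \<in> order_ideals n" using Cons.prems by simp
  have "(\<Sum>x = c..n. of_bool (j \<le> height J \<and> last_entry J j = x)) = (of_bool ((j, c) \<in> J) :: nat)"
  proof (cases "j \<le> height J")
    case True
    have "(\<Sum>x = c..n. of_bool (j \<le> height J \<and> last_entry J j = x)) = (\<Sum>x = c..n. if x = last_entry J j then 1 else (0 :: nat))"
      using True by (intro sum.cong) auto
    also have "\<dots> = of_bool (c \<le> last_entry J j)"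
      using last_entry_bounds(3)[OF J assms(2) True] by simp
    finally show ?thesis using mem_iff_last_entry[OF J assms(2-4)] True by simp
  qed (use mem_iff_last_entry[OF J assms(2-4)] in simp)
  moreover have "entry_count (J # Js) j x = of_bool (j \<le> height J \<and> last_entry J j = x) + entry_count Js j x" for x
    by (simp add: entry_count_def)
  ultimately show ?case using Cons by (simp add: sum.distrib mem_count_def)
qed (simp add: mem_count_def entry_count_def)

text \<open>In a chain, the number of ideals that contain at least one of two given elements is the maximum of the two numbers.\<close>

lemma mem_count_C:
  assumes "set Js \<subseteq> order_ideals n" "sorted_wrt (\<subseteq>) Js" "1 \<le> j" "j < c" "(j, c) \<notin> Os"
  shows "mem_count Js j c = entry_count Js j c + max (mem_count Js j (Suc c)) (mem_count Js (Suc j) c)"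
proof -
  have "mem_count Js j c = entry_count Js j c + length (filter (\<lambda>J. (j, Suc c) \<in> J \<or> (Suc j, c) \<in> J) Js)"
    using assms(1)
  proof (induction Js)
    case (Cons J Js)
    have J: "J \<in> order_ideals n" using Cons.prems by simp
    show ?case using Cons mem_C_iff[OF J assms(3-5)] by (auto simp: mem_count_def entry_count_def)
  qed (simp add: mem_count_def entry_count_def)
  then show ?thesis using chain_count_disj[OF assms(2)] by (simp add: mem_count_def)
qed

text \<open>The number of ideals containing \<open>(j, c)\<close> is computed from the exponent and from the numbers for
  the positions to the right of and below \<open>(j, c)\<close>, hence by induction on \<open>2n - (j + c)\<close>.\<close>

lemma chain_determined_by_lead_exponent:
  assumes Js: "set Js \<subseteq> order_ideals n" "sorted_wrt (\<subseteq>) Js" "\<And>J. J \<in> set Js \<Longrightarrow> 1 \<le> height J"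
    and Ks: "set Ks \<subseteq> order_ideals n" "sorted_wrt (\<subseteq>) Ks" "\<And>J. J \<in> set Ks \<Longrightarrow> 1 \<le> height J"
    and eq: "(\<Sum>J\<leftarrow>Js. lead_exponent (tuple J)) = (\<Sum>J\<leftarrow>Ks. lead_exponent (tuple J))"
  shows "Js = Ks"
proof -
  have E: "entry_count Js j c = entry_count Ks j c" if "1 \<le> j" "j \<le> n" "c \<in> {1..n}" for j c
    using lookup_chain_lead_exponent[OF Js(1) that] lookup_chain_lead_exponent[OF Ks(1) that] eq by simp
  have out: "mem_count Ls j c = 0" if "set Ls \<subseteq> order_ideals n" "\<not> (1 \<le> j \<and> j \<le> c \<and> c \<le> n)" for Ls j c
    using that ideal_pos unfolding mem_count_def by (auto simp: filter_empty_conv)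
  have N: "mem_count Js j c = mem_count Ks j c" for j c
  proof (induction "2 * n - (j + c)" arbitrary: j c rule: less_induct)
    case less
    show ?case
    proof (cases "1 \<le> j \<and> j \<le> c \<and> c \<le> n")
      case False
      then show ?thesis using out[OF Js(1)] out[OF Ks(1)] by metis
    next
      case T: True
      show ?thesis
      proof (cases "(j, c) \<in> Os \<or> c = j")
        case True
        show ?thesis
          unfolding mem_count_O[OF Js(1) _ _ True, OF conjunct1[OF T] conjunct1[OF conjunct2[OF T]]]
            mem_count_O[OF Ks(1) _ _ True, OF conjunct1[OF T] conjunct1[OF conjunct2[OF T]]]
          using T by (intro sum.cong refl E) auto
      next
        case False
        then have jc: "1 \<le> j" "j < c" "(j, c) \<notin> Os" using T by auto
        have "mem_count Js j (Suc c) = mem_count Ks j (Suc c)" using jc T by (intro less) auto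
        moreover have "mem_count Js (Suc j) c = mem_count Ks (Suc j) c" using jc T by (intro less) auto
        ultimately show ?thesis using mem_count_C[OF Js(1,2) jc] mem_count_C[OF Ks(1,2) jc] E[of j c] jc T by simp
      qed
    qed
  qed
  have len: "length Ls = mem_count Ls 1 1"
    if "set Ls \<subseteq> order_ideals n" "\<And>J. J \<in> set Ls \<Longrightarrow> 1 \<le> height J" for Ls
  proof -
    have "(1, 1) \<in> J" if "J \<in> set Ls" for J
      using diag_mem_iff[of J 1] that \<open>set Ls \<subseteq> order_ideals n\<close> \<open>\<And>J. J \<in> set Ls \<Longrightarrow> 1 \<le> height J\<close> by auto
    then have "filter (\<lambda>J. (1, 1) \<in> J) Ls = Ls" by (intro filter_True) auto
    then show ?thesis unfolding mem_count_def by simp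
  qed
  have l: "length Js = length Ks" using len[OF Js(1,3)] len[OF Ks(1,3)] N by simp
  show ?thesis
  proof (rule nth_equalityI[OF l])
    fix i assume i: "i < length Js"
    show "Js ! i = Ks ! i"
    proof (rule Set.set_eqI)
      fix p :: "nat \<times> nat"
      obtain j c where p: "p = (j, c)" by (cases p)
      show "p \<in> Js ! i \<longleftrightarrow> p \<in> Ks ! i"
        using chain_nth_mem_iff[OF Js(2) i, of p] chain_nth_mem_iff[OF Ks(2), of i p] i l N[of j c]
        unfolding p mem_count_def by simp
    qed
  qed
qed
end

section \<open>Bases of the Pluecker algebra\<close>

lemma subspace_polys_over: "cpoly.subspace (polys_over V)"
proof (rule cpoly.subspaceI)
  show "0 \<in> polys_over V" by (simp add: polys_over_def)
  show "x + y \<in> polys_over V" if "x \<in> polys_over V" "y \<in> polys_over V" for x y :: "'a cpoly"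
  proof -
    have "Poly_Mapping.keys (x + y) \<subseteq> Poly_Mapping.keys x \<union> Poly_Mapping.keys y" by (rule keys_add)
    then show ?thesis using that unfolding polys_over_def by blast
  qed
  show "scale_cpoly c x \<in> polys_over V" if "x \<in> polys_over V" for c and x :: "'a cpoly"
    using that by (auto simp: polys_over_def scale_cpoly_def lookup_Const_mult in_keys_iff)
qed

lemma polys_over_mult:
  assumes "p \<in> polys_over V" "q \<in> polys_over V"
  shows "p * q \<in> polys_over V"
  unfolding polys_over_def
proof (intro CollectI ballI)
  fix m assume "m \<in> Poly_Mapping.keys (p * q)"
  then obtain a b where "a \<in> Poly_Mapping.keys p" "b \<in> Poly_Mapping.keys q" "m = a + b"
    using keys_mult[of p q] by blast
  moreover have "Poly_Mapping.keys (a + b) \<subseteq> Poly_Mapping.keys a \<union> Poly_Mapping.keys b" by (rule keys_add)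
  ultimately show "Poly_Mapping.keys m \<subseteq> V" using assms unfolding polys_over_def by blast
qed

lemma polys_over_1: "1 \<in> polys_over V"
  by (auto simp: polys_over_def)

lemma polys_over_Var: "v \<in> V \<Longrightarrow> Var v \<in> polys_over V"
  by (auto simp: polys_over_def Var_def)

lemma polys_over_prod_list:
  "(\<And>x. x \<in> set xs \<Longrightarrow> g x \<in> polys_over V) \<Longrightarrow> (\<Prod>x\<leftarrow>xs. g x) \<in> polys_over V"
  by (induction xs) (auto intro: polys_over_1 polys_over_mult)

lemma X_pl_in_ring:
  assumes "set xs \<subseteq> {1..n}" "length xs \<in> D"
  shows "X_pl xs \<in> pluecker_poly_ring n D"
proof (cases "distinct xs")
  case True
  then have "sort xs \<in> pluecker_indices n D"
    using assms by (simp add: pluecker_indices_def strict_sorted_iff)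
  then show ?thesis using True polys_over_Var[of "sort xs" "pluecker_indices n D"]
    cpoly.subspace_scale[OF subspace_polys_over]
    by (simp add: X_pl_def pluecker_poly_ring_def scale_of_int)
next
  case False
  then show ?thesis using cpoly.subspace_0[OF subspace_polys_over]
    by (simp add: X_pl_def pluecker_poly_ring_def)
qed

lemma subspace_pluecker_algebra: "cpoly.subspace (pluecker_algebra n D)"
proof (rule cpoly.subspaceI)
  note s = subspace_polys_over[of "pluecker_indices n D", folded pluecker_poly_ring_def]
  have "pluecker_map 0 = 0" by (simp add: pluecker_map_def poly_hom_0)
  then show "0 \<in> pluecker_algebra n D"
    unfolding pluecker_algebra_def using cpoly.subspace_0[OF s] by (metis imageI)
  fix x assume "x \<in> pluecker_algebra n D"
  then obtain p where p: "p \<in> pluecker_poly_ring n D" "x = pluecker_map p" by (auto simp: pluecker_algebra_def)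
  show "scale_cpoly c x \<in> pluecker_algebra n D" for c
  proof -
    have "scale_cpoly c x = pluecker_map (scale_cpoly c p)" by (simp add: p pluecker_map_def poly_hom_scale)
    then show ?thesis unfolding pluecker_algebra_def using cpoly.subspace_scale[OF s p(1)] by blast
  qed
  fix y assume "y \<in> pluecker_algebra n D"
  then obtain q where q: "q \<in> pluecker_poly_ring n D" "y = pluecker_map q" by (auto simp: pluecker_algebra_def)
  have "x + y = pluecker_map (p + q)" by (simp add: p q pluecker_map_def poly_hom_add)
  then show "x + y \<in> pluecker_algebra n D"
    unfolding pluecker_algebra_def using cpoly.subspace_add[OF s p(1) q(1)] by blast
qed

definition column_chains :: "nat \<Rightarrow> nat set \<Rightarrow> nat \<Rightarrow> nat list list set" where
  "column_chains n D m = {Y. length Y = m \<and> (\<forall>c\<in>set Y. is_col n c \<and> length c \<in> D) \<and> sorted_wrt col_ge Y}"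

definition ideal_chains :: "nat \<Rightarrow> nat set \<Rightarrow> nat \<Rightarrow> (nat \<times> nat) set list set" where
  "ideal_chains n D m = {Js. length Js = m \<and> set Js \<subseteq> order_ideals_in n D \<and> sorted_wrt (\<subseteq>) Js}"

lemma finite_column_chains: "finite (column_chains n D m)"
proof -
  let ?C = "{c. set c \<subseteq> {1..n} \<and> length c \<le> n}"
  have "finite {Y. set Y \<subseteq> ?C \<and> length Y = m}"
    by (intro finite_lists_length_eq finite_lists_length_le) simp
  moreover have "column_chains n D m \<subseteq> {Y. set Y \<subseteq> ?C \<and> length Y = m}"
    using is_col_bounds(1) by (auto simp: column_chains_def is_col_def)
  ultimately show ?thesis by (rule finite_subset[rotated])
qed

lemma finite_ideal_chains: "finite (ideal_chains n D m)"
proof -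
  have "pos n \<subseteq> {1..n} \<times> {1..n}" by (auto simp: pos_def)
  then have "finite (pos n)" by (rule finite_subset) simp
  then have "finite {Js. set Js \<subseteq> Pow (pos n) \<and> length Js = m}"
    by (intro finite_lists_length_eq) simp
  moreover have "ideal_chains n D m \<subseteq> {Js. set Js \<subseteq> Pow (pos n) \<and> length Js = m}"
    by (auto simp: ideal_chains_def order_ideals_in_def order_ideals_def)
  ultimately show ?thesis by (rule finite_subset[rotated])
qed

text \<open>The \<open>j\<close>-th row ends in column \<open>c\<^sub>j + j - 1\<close>, where \<open>c\<^sub>j = c ! (j - 1)\<close>. As \<open>c\<close> decreases strictly, the row ends decrease
  weakly.\<close>

definition column_ideal :: "nat list \<Rightarrow> (nat \<times> nat) set" where
  "column_ideal c = {(j, x). 1 \<le> j \<and> j \<le> length c \<and> j \<le> x \<and> x < c ! (j - 1) + j}"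

lemma is_col_gap:
  assumes c: "is_col n c" and "i \<le> j" "j < length c"
  shows "c ! j + (j - i) \<le> c ! i"
  using assms(2,3)
proof (induction j rule: dec_induct)
  case (step j)
  then have "c ! Suc j < c ! j" using c by (simp add: is_col_def sorted_wrt_iff_nth_less)
  then show ?case using step by simp
qed simp

lemma is_col_nth: "is_col n c \<Longrightarrow> j < length c \<Longrightarrow> 1 \<le> c ! j \<and> c ! j \<le> n"
proof -
  assume "is_col n c" "j < length c"
  then have "c ! j \<in> {1..n}" using nth_mem unfolding is_col_def by blast
  then show ?thesis by simp
qed

lemma column_ideal:
  assumes c: "is_col n c"
  shows "column_ideal c \<in> order_ideals n" and "card (column_ideal c \<inter> diag n) = length c"
proof -
  have "c ! (j - 1) + j \<le> c ! (i - 1) + i" if "1 \<le> i" "i \<le> j" "j \<le> length c" for i j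
  proof -
    have "c ! (j - 1) + ((j - 1) - (i - 1)) \<le> c ! (i - 1)" by (rule is_col_gap[OF c]) (use that in auto)
    then show ?thesis using that by linarith
  qed
  moreover have "c ! (j - 1) + j \<le> n + 1" if "1 \<le> j" "j \<le> length c" for j
  proof -
    have "c ! (j - 1) + ((j - 1) - 0) \<le> c ! 0" by (rule is_col_gap[OF c]) (use that in auto)
    moreover have "0 < length c" using that by linarith
    then have "c ! 0 \<le> n" using is_col_nth[OF c, of 0] by blast
    ultimately show ?thesis using that by linarith
  qed
  ultimately show "column_ideal c \<in> order_ideals n"
    unfolding order_ideals_def column_ideal_def pos_def ple_def by fastforce
  have "column_ideal c \<inter> diag n = (\<lambda>i. (i, i)) ` {1..length c}"
  proof -
    have "i \<le> n \<and> 1 \<le> c ! (i - 1)" if "1 \<le> i" "i \<le> length c" for i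
      using is_col_nth[OF c, of "i - 1"] is_col_bounds(1)[OF c] that by linarith
    then show ?thesis unfolding column_ideal_def diag_def by fastforce
  qed
  then show "card (column_ideal c \<inter> diag n) = length c" by (simp add: card_image inj_on_def)
qed

lemma column_ideal_mono: "col_ge a b \<Longrightarrow> column_ideal b \<subseteq> column_ideal a"
proof (rule subrelI)
  fix j x assume ab: "col_ge a b" and jx: "(j, x) \<in> column_ideal b"
  have "j - 1 < length b" using jx by (auto simp: column_ideal_def)
  then have "b ! (j - 1) \<le> a ! (j - 1)" using ab by (simp add: col_ge_def)
  then show "(j, x) \<in> column_ideal a" using ab jx by (simp add: column_ideal_def col_ge_def)
qed

lemma column_ideal_inj:
  assumes c: "is_col n c" "is_col n d" and eq: "column_ideal c = column_ideal d"
  shows "c = d"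
proof (rule nth_equalityI)
  show l: "length c = length d" using column_ideal(2)[OF c(1)] column_ideal(2)[OF c(2)] eq by simp
  have le: "c ! i \<le> d ! i" if "is_col n c" "is_col n d" "column_ideal c = column_ideal d" "i < length c" for c d i
  proof -
    have "(Suc i, c ! i + i) \<in> column_ideal c"
      using that(4) is_col_nth[OF that(1,4)] by (simp add: column_ideal_def)
    then show ?thesis unfolding that(3) by (simp add: column_ideal_def)
  qed
  fix i assume "i < length c"
  then show "c ! i = d ! i" using le[of c d i] le[of d c i] c eq l by auto
qed

text \<open>The map \<open>column_ideal\<close> is injective and monotone; the list is reversed because chains of columns are
  listed decreasingly.\<close>

lemma card_column_chains_le: "card (column_chains n D m) \<le> card (ideal_chains n D m)"
proof (rule card_inj_on_le[OF _ _ finite_ideal_chains])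
  let ?f = "\<lambda>Y. rev (map column_ideal Y)"
  show "inj_on ?f (column_chains n D m)"
  proof (rule inj_onI)
    fix Y Z assume YZ: "Y \<in> column_chains n D m" "Z \<in> column_chains n D m" "?f Y = ?f Z"
    have "inj_on column_ideal (set Y \<union> set Z)"
    proof (rule inj_onI)
      fix c d assume cd: "c \<in> set Y \<union> set Z" "d \<in> set Y \<union> set Z" and eq: "column_ideal c = column_ideal d"
      have "is_col n c" "is_col n d" using cd YZ(1,2) by (auto simp: column_chains_def)
      then show "c = d" using eq by (rule column_ideal_inj)
    qed
    then show "Y = Z" using YZ(3) by (metis map_inj_on rev_is_rev_conv)
  qed
  show "?f ` column_chains n D m \<subseteq> ideal_chains n D m"
  proof safe
    fix Y assume Y: "Y \<in> column_chains n D m"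
    have "sorted_wrt (\<lambda>a b. column_ideal b \<subseteq> column_ideal a) Y"
      using Y column_ideal_mono unfolding column_chains_def
      by (metis (mono_tags, lifting) mem_Collect_eq sorted_wrt_mono_rel)
    then show "?f Y \<in> ideal_chains n D m"
      using Y column_ideal by (auto simp: ideal_chains_def column_chains_def sorted_wrt_rev sorted_wrt_map order_ideals_in_def)
  qed
qed

definition column_products :: "nat \<Rightarrow> nat set \<Rightarrow> (nat \<times> nat) cpoly set" where
  "column_products n D = {\<Prod>c\<in>#M. minor c | M. \<forall>c\<in>#M. is_col n c \<and> length c \<in> D}"

lemma column_products_mult:
  assumes "x \<in> cpoly.span (column_products n D)" "y \<in> cpoly.span (column_products n D)"
  shows "x * y \<in> cpoly.span (column_products n D)"
proof (rule span_mult_right[OF assms(1)])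
  fix s assume s: "s \<in> column_products n D"
  have "y * s \<in> cpoly.span (column_products n D)"
  proof (rule span_mult_right[OF assms(2)], rule cpoly.span_base)
    fix t assume "t \<in> column_products n D"
    then obtain M N where "t = (\<Prod>c\<in>#M. minor c)" "\<forall>c\<in>#M. is_col n c \<and> length c \<in> D"
      "s = (\<Prod>c\<in>#N. minor c)" "\<forall>c\<in>#N. is_col n c \<and> length c \<in> D"
      using s by (auto simp: column_products_def)
    then show "t * s \<in> column_products n D" unfolding column_products_def
      by (intro CollectI exI[of _ "M + N"]) auto
  qed
  then show "s * y \<in> cpoly.span (column_products n D)" by (simp add: mult.commute)
qed

lemma column_products_1: "1 \<in> cpoly.span (column_products n D)"
  unfolding column_products_def by (rule cpoly.span_base) (auto intro: exI[of _ "{#}"])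

lemma minor_in_column_products:
  assumes "xs \<in> pluecker_indices n D"
  shows "minor xs \<in> cpoly.span (column_products n D)"
proof -
  have xs: "distinct xs" "set xs \<subseteq> {1..n}" "length xs \<in> D"
    using assms by (auto simp: pluecker_indices_def strict_sorted_iff)
  let ?c = "rev (sort xs)"
  obtain e where e: "minor xs = of_int e * minor ?c" using minor_sorted_column by blast
  have "minor ?c \<in> column_products n D" unfolding column_products_def
    using is_colI[OF xs(1,2)] xs(3) by (intro CollectI exI[of _ "{#?c#}"]) simp
  then show ?thesis unfolding e scale_of_int by (intro cpoly.span_scale cpoly.span_base)
qed

lemma pluecker_algebra_subset: "pluecker_algebra n D \<subseteq> cpoly.span (column_products n D)"
proof
  let ?V = "cpoly.span (column_products n D)"
  fix x assume "x \<in> pluecker_algebra n D"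
  then obtain p where p: "p \<in> pluecker_poly_ring n D" "x = pluecker_map p" by (auto simp: pluecker_algebra_def)
  have pow: "a ^ k \<in> ?V" if "a \<in> ?V" for a k
    using that by (induction k) (auto intro: column_products_1 column_products_mult)
  have prd: "(\<Prod>v\<in>A. g v) \<in> ?V" if "\<And>v. v \<in> A \<Longrightarrow> g v \<in> ?V" for A and g :: "nat list \<Rightarrow> (nat \<times> nat) cpoly"
    using that by (induction A rule: infinite_finite_induct) (auto intro: column_products_1 column_products_mult)
  have "monom_eval minor m \<in> ?V" if "m \<in> Poly_Mapping.keys p" for m
    unfolding monom_eval_def using p(1) that
    by (intro prd pow minor_in_column_products) (auto simp: pluecker_poly_ring_def polys_over_def)
  then have "(\<Sum>m\<in>Poly_Mapping.keys p. scale_cpoly (Poly_Mapping.lookup p m) (monom_eval minor m)) \<in> ?V"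
    by (intro cpoly.span_sum cpoly.span_scale)
  moreover have "x = (\<Sum>m\<in>Poly_Mapping.keys p. scale_cpoly (Poly_Mapping.lookup p m) (monom_eval minor m))"
    unfolding p(2) pluecker_map_def by (subst poly_hom_superset[OF finite_keys order_refl]) (simp add: scale_cpoly_def)
  ultimately show "x \<in> ?V" by simp
qed

text \<open>An element of \<open>A\<close> outside the span of \<open>B\<close> could be added to \<open>B\<close>, giving an independent set in
  the span of \<open>A\<close> that has more elements than \<open>A\<close>.\<close>

lemma (in vector_space) span_subset_span_if_card_le:
  assumes A: "finite A" and B: "independent B" "B \<subseteq> span A" and card: "card A \<le> card B"
  shows "span A \<subseteq> span B"
proof (rule span_minimal[OF _ subspace_span], rule subsetI, rule ccontr)
  fix v assume v: "v \<in> A" "v \<notin> span B"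
  then have "independent (insert v B)" using B(1) independent_insertI by blast
  moreover have "insert v B \<subseteq> span A" using B(2) v(1) span_base by blast
  ultimately have "finite (insert v B) \<and> card (insert v B) \<le> card A"
    by (rule independent_span_bound[OF A])
  moreover have "v \<notin> B" using v(2) span_base by blast
  ultimately show False using card by (auto simp: card_insert_disjoint)
qed

context oc_partition
begin

definition chain_product :: "(nat \<times> nat) set list \<Rightarrow> (nat \<times> nat) cpoly" where
  "chain_product Js = (\<Prod>J\<leftarrow>Js. minor (tuple J))"

definition chain_monomial :: "(nat \<times> nat) set list \<Rightarrow> nat list cpoly" where
  "chain_monomial Js = (\<Prod>J\<leftarrow>Js. X_pl (tuple J))"

lemma psi_chain: "psi n Os (\<Prod>J\<leftarrow>Js. Var J) = chain_monomial Js"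
  unfolding psi_def chain_monomial_def by (simp add: poly_hom_prod_list poly_hom_Var tuple_def del: upt_Suc)

lemma tuple_distinct: "distinct (tuple J)"
proof -
  have "inj (w J)" unfolding w_ideal_def w_perm_upper_rows by (rule permutes_inj[OF upper_rows_permutes])
  then show ?thesis unfolding tuple_def by (simp add: distinct_map inj_on_subset)
qed

lemma tuple_range: "J \<in> order_ideals n \<Longrightarrow> set (tuple J) \<subseteq> {1..n}"
  unfolding tuple_def using w_in height_le by force

lemma pluecker_map_chain_monomial: "pluecker_map (chain_monomial Js) = chain_product Js"
  unfolding chain_monomial_def chain_product_def pluecker_map_def poly_hom_prod_list
  by (simp add: pluecker_map_X_pl[unfolded pluecker_map_def] tuple_distinct)

context
  fixes D :: "nat set"
  assumes D: "D \<subseteq> {1..n - 1}"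
begin

lemma ideal_in_D:
  assumes "J \<in> order_ideals_in n D"
  shows "J \<in> order_ideals n" "height J \<in> D" "1 \<le> height J" "height J \<le> n - 1"
proof -
  show J: "J \<in> order_ideals n" "height J \<in> D" using assms by (auto simp: order_ideals_in_def)
  have "height J \<in> {1..n - 1}" using J(2) D by blast
  then show "1 \<le> height J" "height J \<le> n - 1" by simp_all
qed

lemma chain_product_leads:
  assumes "set Js \<subseteq> order_ideals_in n D"
  shows "leads weight (chain_product Js) (\<Sum>J\<leftarrow>Js. lead_exponent (tuple J))"
  unfolding chain_product_def
proof (rule leads_prod_list)
  fix J assume "J \<in> set Js"
  then have "J \<in> order_ideals_in n D" using assms by blast
  note J = ideal_in_D[OF this]
  show "leads weight (minor (tuple J)) (lead_exponent (tuple J))"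
    by (rule minor_leads[OF OC_tuple_tuple[OF J(1,3,4)]])
qed

lemma chain_product_inj:
  assumes Js: "Js \<in> ideal_chains n D m" and Ks: "Ks \<in> ideal_chains n D k"
    and eq: "\<And>\<mu>. leads weight (chain_product Js) \<mu> \<longleftrightarrow> leads weight (chain_product Ks) \<mu>"
  shows "Js = Ks"
proof (rule chain_determined_by_lead_exponent)
  have s: "set Js \<subseteq> order_ideals_in n D" "set Ks \<subseteq> order_ideals_in n D"
    "sorted_wrt (\<subseteq>) Js" "sorted_wrt (\<subseteq>) Ks" using Js Ks by (auto simp: ideal_chains_def)
  show "sorted_wrt (\<subseteq>) Js" "sorted_wrt (\<subseteq>) Ks" by fact+
  show "set Js \<subseteq> order_ideals n" "set Ks \<subseteq> order_ideals n"
    using s(1,2) by (auto simp: order_ideals_in_def)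
  show "1 \<le> height J" if "J \<in> set Js" for J using that s(1) ideal_in_D(3) by blast
  show "1 \<le> height J" if "J \<in> set Ks" for J using that s(2) ideal_in_D(3) by blast
  have "leads weight (chain_product Ks) (\<Sum>J\<leftarrow>Js. lead_exponent (tuple J))"
    using chain_product_leads[OF s(1)] eq by blast
  then show "(\<Sum>J\<leftarrow>Js. lead_exponent (tuple J)) = (\<Sum>J\<leftarrow>Ks. lead_exponent (tuple J))"
    by (rule leads_unique[OF _ chain_product_leads[OF s(2)]])
qed

lemma chain_products_independent: "cpoly.independent (chain_product ` (\<Union>m. ideal_chains n D m))"
proof (rule leads_independent)
  fix p assume p: "p \<in> chain_product ` (\<Union>m. ideal_chains n D m)"
  then have "\<exists>\<mu>. leads weight p \<mu>" using chain_product_leads by (auto simp: ideal_chains_def)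
  \<comment> \<open>The leading exponent is unique, so choosing one makes it a function of the product.\<close>
  then show "leads weight p (SOME \<mu>. leads weight p \<mu>)" by (rule someI_ex)
next
  show "inj_on (\<lambda>p. SOME \<mu>. leads weight p \<mu>) (chain_product ` (\<Union>m. ideal_chains n D m))"
  proof (rule inj_onI)
    fix p q assume p: "p \<in> chain_product ` (\<Union>m. ideal_chains n D m)"
      and q: "q \<in> chain_product ` (\<Union>m. ideal_chains n D m)"
      and eq: "(SOME \<mu>. leads weight p \<mu>) = (SOME \<mu>. leads weight q \<mu>)"
    obtain Js m where Js: "Js \<in> ideal_chains n D m" "p = chain_product Js" using p by blast
    obtain Ks k where Ks: "Ks \<in> ideal_chains n D k" "q = chain_product Ks" using q by blast
    have "\<exists>\<mu>. leads weight p \<mu>" using chain_product_leads Js by (auto simp: ideal_chains_def)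
    then have 1: "leads weight p (SOME \<mu>. leads weight p \<mu>)" by (rule someI_ex)
    have "\<exists>\<mu>. leads weight q \<mu>" using chain_product_leads Ks by (auto simp: ideal_chains_def)
    then have 2: "leads weight q (SOME \<mu>. leads weight p \<mu>)" unfolding eq by (rule someI_ex)
    have "leads weight p \<mu> \<longleftrightarrow> leads weight q \<mu>" for \<mu>
      using leads_unique[OF 1, of \<mu>] leads_unique[OF 2, of \<mu>] 1 2 by blast
    then show "p = q" using chain_product_inj[OF Js(1) Ks(1)] Js(2) Ks(2) by simp
  qed
qed

lemma chain_product_in_span:
  assumes Js: "Js \<in> ideal_chains n D m"
  shows "chain_product Js \<in> cpoly.span ((\<lambda>Y. \<Prod>c\<leftarrow>Y. minor c) ` column_chains n D m)"
proof -
  let ?c = "\<lambda>J. rev (sort (tuple J))"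
  have s: "set Js \<subseteq> order_ideals_in n D" "length Js = m" using Js by (auto simp: ideal_chains_def)
  have "\<exists>e :: int. chain_product Js = of_int e * (\<Prod>c\<in>#mset (map ?c Js). minor c)" for Js
  proof (induction Js)
    case Nil
    show ?case by (intro exI[of _ 1]) (simp add: chain_product_def)
  next
    case (Cons J Js)
    then obtain e where e: "chain_product Js = of_int e * (\<Prod>c\<in>#mset (map ?c Js). minor c)" by blast
    obtain f where f: "minor (tuple J) = of_int f * minor (?c J)" using minor_sorted_column by blast
    have "chain_product (J # Js) = minor (tuple J) * chain_product Js" by (simp add: chain_product_def)
    also have "\<dots> = of_int (f * e) * (\<Prod>c\<in>#mset (map ?c (J # Js)). minor c)"
      unfolding e f by (simp add: mult_ac)
    finally show ?case by blast
  qed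
  then obtain e where e: "chain_product Js = of_int e * (\<Prod>c\<in>#mset (map ?c Js). minor c)" by blast
  have "(\<Prod>c\<in>#mset (map ?c Js). minor c) \<in> cpoly.span {\<Prod>c\<leftarrow>Y. minor c | Y.
     length Y = size (mset (map ?c Js)) \<and> (\<forall>c\<in>set Y. is_col n c \<and> length c \<in> D) \<and> sorted_wrt col_ge Y}"
  proof (rule column_straightening)
    fix c assume "c \<in># mset (map ?c Js)"
    then obtain J where J: "J \<in> set Js" "c = ?c J" by auto
    then have "J \<in> order_ideals_in n D" using s(1) by blast
    note i = ideal_in_D[OF this]
    show "is_col n c \<and> length c \<in> D"
      unfolding J(2) using is_colI[OF tuple_distinct tuple_range[OF i(1)]] i(2) by (simp add: tuple_simps)
  qed
  moreover have "{\<Prod>c\<leftarrow>Y. minor c | Y.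
     length Y = size (mset (map ?c Js)) \<and> (\<forall>c\<in>set Y. is_col n c \<and> length c \<in> D) \<and> sorted_wrt col_ge Y}
     = (\<lambda>Y. \<Prod>c\<leftarrow>Y. minor c) ` column_chains n D m"
    using s(2) by (auto simp: column_chains_def)
  ultimately show ?thesis unfolding e scale_of_int by (intro cpoly.span_scale) simp
qed

text \<open>Products over chains of ideals are independent, lie in the span of the products over chains of columns, and are
  at least as many.\<close>

lemma column_chains_span:
  "cpoly.span ((\<lambda>Y. \<Prod>c\<leftarrow>Y. minor c) ` column_chains n D m) \<subseteq> cpoly.span (chain_product ` ideal_chains n D m)"
proof (rule cpoly.span_subset_span_if_card_le)
  show "finite ((\<lambda>Y. \<Prod>c\<leftarrow>Y. minor c :: (nat \<times> nat) cpoly) ` column_chains n D m)"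
    by (intro finite_imageI finite_column_chains)
  show "cpoly.independent (chain_product ` ideal_chains n D m)"
    by (rule cpoly.independent_mono[OF chain_products_independent]) blast
  show "chain_product ` ideal_chains n D m \<subseteq> cpoly.span ((\<lambda>Y. \<Prod>c\<leftarrow>Y. minor c) ` column_chains n D m)"
    using chain_product_in_span by blast
  have "inj_on chain_product (ideal_chains n D m)"
    by (rule inj_onI, rule chain_product_inj) auto
  then have "card (chain_product ` ideal_chains n D m) = card (ideal_chains n D m)" by (rule card_image)
  moreover have "card ((\<lambda>Y. \<Prod>c\<leftarrow>Y. minor c :: (nat \<times> nat) cpoly) ` column_chains n D m) \<le> card (column_chains n D m)"
    by (rule card_image_le[OF finite_column_chains])
  ultimately show "card ((\<lambda>Y. \<Prod>c\<leftarrow>Y. minor c :: (nat \<times> nat) cpoly) ` column_chains n D m)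
     \<le> card (chain_product ` ideal_chains n D m)"
    using card_column_chains_le[of n D m] by linarith
qed

lemma chain_products_span:
  "cpoly.span (chain_product ` (\<Union>m. ideal_chains n D m)) = pluecker_algebra n D"
proof
  show "cpoly.span (chain_product ` (\<Union>m. ideal_chains n D m)) \<subseteq> pluecker_algebra n D"
  proof (rule cpoly.span_minimal[OF _ subspace_pluecker_algebra], safe)
    fix Js m assume "Js \<in> ideal_chains n D m"
    then have s: "set Js \<subseteq> order_ideals_in n D" by (simp add: ideal_chains_def)
    have "chain_monomial Js \<in> pluecker_poly_ring n D"
      unfolding chain_monomial_def pluecker_poly_ring_def
    proof (rule polys_over_prod_list, fold pluecker_poly_ring_def)
      fix J assume "J \<in> set Js"
      then have "J \<in> order_ideals_in n D" using s by blast
      note i = ideal_in_D[OF this]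
      show "X_pl (tuple J) \<in> pluecker_poly_ring n D"
        by (rule X_pl_in_ring[OF tuple_range[OF i(1)]]) (simp add: tuple_simps i(2))
    qed
    then show "chain_product Js \<in> pluecker_algebra n D"
      unfolding pluecker_algebra_def pluecker_map_chain_monomial[symmetric] by blast
  qed
  have "column_products n D \<subseteq> cpoly.span (chain_product ` (\<Union>m. ideal_chains n D m))"
  proof
    fix x assume "x \<in> column_products n D"
    then obtain M where M: "x = (\<Prod>c\<in>#M. minor c)" "\<forall>c\<in>#M. is_col n c \<and> length c \<in> D"
      by (auto simp: column_products_def)
    have "x \<in> cpoly.span {\<Prod>c\<leftarrow>Y. minor c | Y.
       length Y = size M \<and> (\<forall>c\<in>set Y. is_col n c \<and> length c \<in> D) \<and> sorted_wrt col_ge Y}"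
      unfolding M(1) by (rule column_straightening) (use M(2) in blast)
    moreover have "{\<Prod>c\<leftarrow>Y. minor c | Y.
       length Y = size M \<and> (\<forall>c\<in>set Y. is_col n c \<and> length c \<in> D) \<and> sorted_wrt col_ge Y}
       = (\<lambda>Y. \<Prod>c\<leftarrow>Y. minor c) ` column_chains n D (size M)" by (auto simp: column_chains_def)
    ultimately have "x \<in> cpoly.span ((\<lambda>Y. \<Prod>c\<leftarrow>Y. minor c) ` column_chains n D (size M))" by (simp only:)
    then have "x \<in> cpoly.span (chain_product ` ideal_chains n D (size M))"
      using column_chains_span by blast
    moreover have "cpoly.span (chain_product ` ideal_chains n D (size M))
      \<subseteq> cpoly.span (chain_product ` (\<Union>m. ideal_chains n D m))" by (intro cpoly.span_mono) blast
    ultimately show "x \<in> cpoly.span (chain_product ` (\<Union>m. ideal_chains n D m))" by blast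
  qed
  then have "cpoly.span (column_products n D) \<subseteq> cpoly.span (chain_product ` (\<Union>m. ideal_chains n D m))"
    by (intro cpoly.span_minimal cpoly.subspace_span)
  then show "pluecker_algebra n D \<subseteq> cpoly.span (chain_product ` (\<Union>m. ideal_chains n D m))"
    using pluecker_algebra_subset by blast
qed

lemma standard_monomials_eq: "standard_monomials n Os D = chain_monomial ` (\<Union>m. ideal_chains n D m)"
proof -
  have "(\<Union>m. ideal_chains n D m) = {Js. set Js \<subseteq> order_ideals_in n D \<and> sorted_wrt (\<subseteq>) Js}"
    by (auto simp: ideal_chains_def)
  then show ?thesis unfolding standard_monomials_def psi_chain by blast
qed

text \<open>By \<open>\<sigma>_w\<close>, the comparison of entries in the definition of a semistandard tableau is the
  criterion \<open>ideal_subset_iff\<close> for the corresponding ideals. The condition on the shape of the tableau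
  follows from inclusion.\<close>

lemma semistandard_iff:
  assumes Ks: "set Ks \<subseteq> order_ideals_in n D"
  shows "young_tableau (map tuple Ks) \<and> OC_semistandard n Os (map tuple Ks) \<longleftrightarrow> sorted_wrt (\<lambda>J K. K \<subseteq> J) Ks"
proof -
  let ?m = "length Ks"
  have ideal: "J \<in> order_ideals n" "1 \<le> height J" "height J \<le> n - 1" if "J \<in> set Ks" for J
    using ideal_in_D Ks that by blast+
  have cols: "OC_tuple n Os (map tuple Ks ! (i - 1))" if "i \<in> {1..?m}" for i
  proof -
    have "Ks ! (i - 1) \<in> set Ks" using that by (intro nth_mem) auto
    note this[THEN ideal(1)] this[THEN ideal(2)] this[THEN ideal(3)]
    note OC_tuple_tuple[OF this]
    moreover have "i - 1 < length Ks" using that by auto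
    ultimately show ?thesis by simp
  qed
  have fin: "card (J \<inter> diag n) \<le> card (K \<inter> diag n)" if "J \<subseteq> K" for J K
  proof (rule card_mono)
    have "diag n = (\<lambda>i. (i, i)) ` {1..n}" by (auto simp: diag_def)
    then show "finite (K \<inter> diag n)" by simp
    show "J \<inter> diag n \<subseteq> K \<inter> diag n" using that by blast
  qed
  have entry: "\<sigma> j (tuple J ! (j - Suc 0)) = last_entry J j" if "J \<in> order_ideals n" "1 \<le> j" "j \<le> height J" for J j
    using tuple_simps(2)[of "j - 1" J] \<sigma>_w[OF that] that by simp
  have young: "young_tableau (map tuple Ks) \<longleftrightarrow> sorted_wrt (\<lambda>J K. height K \<le> height J) Ks"
    by (simp add: young_tableau_def sorted_wrt_map tuple_simps)
  have pair: "(\<forall>j\<in>{1..length (map tuple Ks ! (i - 1))}. \<exists>j'\<in>{j..length (map tuple Ks ! (i' - 1))}.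
          \<sigma> j' (map tuple Ks ! (i' - 1) ! (j' - 1)) \<ge> \<sigma> j (map tuple Ks ! (i - 1) ! (j - 1)))
       \<longleftrightarrow> Ks ! (i - 1) \<subseteq> Ks ! (i' - 1)"
    if "i \<in> {1..?m}" "i' \<in> {1..i}" "height (Ks ! (i - 1)) \<le> height (Ks ! (i' - 1))" for i i'
  proof -
    have "Ks ! (i - 1) \<in> set Ks" "Ks ! (i' - 1) \<in> set Ks" using that by (auto intro!: nth_mem)
    then have J: "Ks ! (i - 1) \<in> order_ideals n" "Ks ! (i' - 1) \<in> order_ideals n" using ideal by auto
    have n: "map tuple Ks ! (i - 1) = tuple (Ks ! (i - 1))" "map tuple Ks ! (i' - 1) = tuple (Ks ! (i' - 1))"
      using that by (auto intro!: nth_map)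
    show ?thesis
      unfolding n tuple_simps(1) ideal_subset_iff[OF J that(3)]
    proof (intro ball_cong bex_cong refl)
      fix j j' assume "j \<in> {1..height (Ks ! (i - 1))}" "j' \<in> {j..height (Ks ! (i' - 1))}"
      then have j: "1 \<le> j" "j \<le> height (Ks ! (i - 1))" and j': "1 \<le> j'" "j' \<le> height (Ks ! (i' - 1))" by auto
      show "\<sigma> j (tuple (Ks ! (i - 1)) ! (j - 1)) \<le> \<sigma> j' (tuple (Ks ! (i' - 1)) ! (j' - 1))
        \<longleftrightarrow> last_entry (Ks ! (i - 1)) j \<le> last_entry (Ks ! (i' - 1)) j'"
        using entry[OF J(1) j] entry[OF J(2) j'] by simp
    qed
  qed
  show ?thesis
  proof
    assume a: "young_tableau (map tuple Ks) \<and> OC_semistandard n Os (map tuple Ks)"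
    show "sorted_wrt (\<lambda>J K. K \<subseteq> J) Ks"
      unfolding sorted_wrt_iff_nth_less
    proof (intro allI impI)
      fix i' i assume i: "i' < i" "i < length Ks"
      then have h: "height (Ks ! i) \<le> height (Ks ! i')"
        using a young by (simp add: sorted_wrt_iff_nth_less)
      have ii: "Suc i \<in> {1..?m}" "Suc i' \<in> {1..Suc i}" using i by auto
      have "\<forall>j\<in>{1..length (map tuple Ks ! (Suc i - 1))}. \<exists>j'\<in>{j..length (map tuple Ks ! (Suc i' - 1))}.
          \<sigma> j' (map tuple Ks ! (Suc i' - 1) ! (j' - 1)) \<ge> \<sigma> j (map tuple Ks ! (Suc i - 1) ! (j - 1))"
        using a ii unfolding OC_semistandard_def Let_def length_map by blast
      then show "Ks ! i \<subseteq> Ks ! i'" using pair[OF ii] h by simp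
    qed
  next
    assume s: "sorted_wrt (\<lambda>J K. K \<subseteq> J) Ks"
    then have srt: "sorted_wrt (\<lambda>J K. height K \<le> height J) Ks"
      by (rule sorted_wrt_mono_rel[rotated]) (rule fin)
    have sub: "Ks ! (i - 1) \<subseteq> Ks ! (i' - 1)" if "i \<in> {1..?m}" "i' \<in> {1..i}" for i i'
    proof (cases "i = i'")
      case False
      then have "i' - 1 < i - 1" "i - 1 < length Ks" using that by auto
      then show ?thesis using s unfolding sorted_wrt_iff_nth_less by blast
    qed simp
    show "young_tableau (map tuple Ks) \<and> OC_semistandard n Os (map tuple Ks)"
      unfolding young OC_semistandard_def Let_def length_map
    proof (intro conjI ballI)
      fix i i' j assume i: "i \<in> {1..?m}" "i' \<in> {1..i}" and j: "j \<in> {1..length (map tuple Ks ! (i - 1))}"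
      note sub[OF i]
      from bspec[OF iffD2[OF pair[OF i fin[OF this]] this] j]
      show "\<exists>j'\<in>{j..length (map tuple Ks ! (i' - 1))}.
        \<sigma> j (map tuple Ks ! (i - 1) ! (j - 1)) \<le> \<sigma> j' (map tuple Ks ! (i' - 1) ! (j' - 1))" .
    qed (use srt cols in blast)+
  qed
qed

text \<open>A tableau is read with its largest column first, a chain of ideals with its smallest member first;
  this accounts for the reversals.\<close>

lemma standard_eq_tableau: "standard_monomials n Os D = tableau_monomials n Os D"
proof (intro equalityI subsetI)
  fix x assume "x \<in> standard_monomials n Os D"
  then obtain Js where Js: "x = chain_monomial Js" "set Js \<subseteq> order_ideals_in n D" "sorted_wrt (\<subseteq>) Js"
    unfolding standard_monomials_eq by (auto simp: ideal_chains_def)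
  let ?Y = "map tuple (rev Js)"
  have "young_tableau ?Y \<and> OC_semistandard n Os ?Y"
    using semistandard_iff[of "rev Js"] Js by (simp add: sorted_wrt_rev)
  moreover have "\<forall>col\<in>set ?Y. length col \<in> D"
    using Js(2) ideal_in_D(2) by (auto simp: tuple_simps)
  moreover have "x = (\<Prod>col\<leftarrow>?Y. X_pl col)"
    by (simp add: Js(1) chain_monomial_def rev_map[symmetric] prod_list.rev o_def)
  ultimately show "x \<in> tableau_monomials n Os D" unfolding tableau_monomials_def by blast
next
  fix x assume "x \<in> tableau_monomials n Os D"
  then obtain Y where Y: "x = (\<Prod>col\<leftarrow>Y. X_pl col)" "young_tableau Y" "\<forall>col\<in>set Y. length col \<in> D"
    "OC_semistandard n Os Y" by (auto simp: tableau_monomials_def)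
  have "\<exists>J. J \<in> order_ideals_in n D \<and> tuple J = c" if c: "c \<in> set Y" for c
  proof -
    obtain i where i: "i < length Y" "Y ! i = c" using c unfolding in_set_conv_nth by blast
    have "\<forall>i\<in>{1..length Y}. OC_tuple n Os (Y ! (i - 1))"
      using Y(4) unfolding OC_semistandard_def Let_def by blast
    from bspec[OF this, of "Suc i"] have "OC_tuple n Os c" using i by simp
    then show ?thesis using OC_tuple_is_tuple[of c] Y(3) c by (auto simp: order_ideals_in_def)
  qed
  then obtain g where g: "\<And>c. c \<in> set Y \<Longrightarrow> g c \<in> order_ideals_in n D \<and> tuple (g c) = c" by metis
  define Ks where "Ks = map g Y"
  have YK: "Y = map tuple Ks" unfolding Ks_def map_map o_def using g by (intro map_idI[symmetric]) auto
  have K: "set Ks \<subseteq> order_ideals_in n D" using g by (auto simp: Ks_def)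
  have "sorted_wrt (\<lambda>J K. K \<subseteq> J) Ks" using semistandard_iff[OF K] Y(2,4) YK by simp
  then have "rev Ks \<in> ideal_chains n D (length Ks)" using K by (simp add: ideal_chains_def sorted_wrt_rev)
  moreover have "x = chain_monomial (rev Ks)"
    unfolding Y(1) YK chain_monomial_def by (simp add: rev_map[symmetric] prod_list.rev o_def)
  ultimately show "x \<in> standard_monomials n Os D" unfolding standard_monomials_eq by blast
qed

theorem standard_monomials_basis:
  "standard_monomials n Os D = tableau_monomials n Os D
    \<and> inj_on pluecker_map (tableau_monomials n Os D)
    \<and> cpoly.independent (pluecker_map ` tableau_monomials n Os D)
    \<and> cpoly.span (pluecker_map ` tableau_monomials n Os D) = pluecker_algebra n D"
proof -
  let ?I = "\<Union>m. ideal_chains n D m"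
  have T: "tableau_monomials n Os D = chain_monomial ` ?I"
    using standard_eq_tableau standard_monomials_eq by simp
  have im: "pluecker_map ` tableau_monomials n Os D = chain_product ` ?I"
    unfolding T image_image pluecker_map_chain_monomial ..
  have inj: "Js = Ks" if I: "Js \<in> ?I" "Ks \<in> ?I" and eq: "chain_product Js = chain_product Ks" for Js Ks
  proof -
    obtain m k where "Js \<in> ideal_chains n D m" "Ks \<in> ideal_chains n D k" using I by blast
    then show ?thesis by (rule chain_product_inj) (simp only: eq)
  qed
  have "inj_on pluecker_map (tableau_monomials n Os D)"
    unfolding T
  proof (rule inj_onI, elim imageE)
    fix p q Js Ks assume p: "p = chain_monomial Js" and q: "q = chain_monomial Ks"
      and I: "Js \<in> ?I" "Ks \<in> ?I" and "pluecker_map p = pluecker_map q"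
    then have "chain_product Js = chain_product Ks" by (simp only: pluecker_map_chain_monomial)
    then show "p = q" unfolding p q by (rule arg_cong[OF inj[OF I]])
  qed
  moreover have "cpoly.independent (pluecker_map ` tableau_monomials n Os D)"
    unfolding im by (rule chain_products_independent)
  moreover have "cpoly.span (pluecker_map ` tableau_monomials n Os D) = pluecker_algebra n D"
    unfolding im by (rule chain_products_span)
  ultimately show ?thesis using standard_eq_tableau by iprover
qed
end
end

theorem theorem3p9:
  fixes n :: nat and Os Cs :: "(nat \<times> nat) set" and d :: "nat list"
  assumes "n > 1"
    and "Os \<union> Cs = pos n - diag n" and "Os \<inter> Cs = {}"
    and "sorted_wrt (<) d" and "set d \<subseteq> {1..n - 1}"
  shows "standard_monomials n Os (set d) = tableau_monomials n Os (set d)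
    \<and> inj_on pluecker_map (tableau_monomials n Os (set d))
    \<and> cpoly.independent (pluecker_map ` tableau_monomials n Os (set d))
    \<and> cpoly.span (pluecker_map ` tableau_monomials n Os (set d)) = pluecker_algebra n (set d)"
proof -
  interpret oc_partition n Os
    by unfold_locales (use assms(2) in blast)
  show ?thesis by (rule standard_monomials_basis[OF assms(5)])
qed

end
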